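(* Let $(G,f)$ be the input pair in the random coloring model, where $G$ is a simple undirected graph on $[n]$ with $m$ edges and $f$ is a coloring of $[n]$ with profile $\mathbf{c}=(c_1,\ldots,c_s)$. Let $M=(M_1,\ldots,M_s)'$ be the outcome of the random coloring model, i.e. $M_i$ is the number of edges of $G$ with both endpoints of color $i$ under a uniformly random coloring of $[n]$ of profile $\mathbf{c}$. (i) The covariance matrix $\Sigma$ of $M$ is of the form $$\Sigma=Q+\gamma(G)\,\mathbf{c}^{\underline{2}}(\mathbf{c}^{\underline{2}})',$$ where $Q=\mathrm{diag}(q_1,\ldots,q_s)$ with $q_i=\sigma_i^2-\gamma(G)\left(c_i^{\underline{2}}\right)^2$. Hence $\Sigma$ is a rank 1 update of the diagonal matrix $Q$. If $Q$ is invertible, so is $\Sigma$, and by the Sherman-Morrison formula $\Sigma^{-1}$ is of the form $$\Sigma^{-1}=\mathrm{diag}(q_1^{-1},\ldots,q_s^{-1})-\frac{\gamma(G)}{1+\gamma(G)\,a'Qa}\,aa',\qquad\text{where } a=Q^{-1}\mathbf{c}^{\underline{2}}.$$ (ii) If $\gamma(G)\le 0$, then $\Sigma_S$ is an $M$-matrix for every nonempty $S\subseteq[s]$, while if $\gamma(G)\ge 0$, then $(\Sigma^{-1})_S$ is an $M$-matrix for every nonempty $S\subseteq[s]$. The same conclusions in (i) and (ii) hold when $\Sigma$ is replaced by the correlation matrix $\Gamma=D^{-1/2}\Sigma D^{-1/2}$ of $M$, where $D=\mathrm{diag}(\sigma_1^2,\ldots,\sigma_s^2)$ (defined provided that $\sigma_i>0$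 for all $i\in[s]$). That is, with $Q$ and $\mathbf{c}^{\underline{2}}$ replaced correspondingly by $\tilde Q=D^{-1/2}QD^{-1/2}$ and $u=D^{-1/2}\mathbf{c}^{\underline{2}}$: $\Gamma=\tilde Q+\gamma(G)\,uu'$ is a rank 1 update of the diagonal matrix $\tilde Q$; if $\tilde Q$ is invertible, so is $\Gamma$, and $$\Gamma^{-1}=\tilde Q^{-1}-\frac{\gamma(G)}{1+\gamma(G)\,b'\tilde Qb}\,bb',\qquad\text{where } b=\tilde Q^{-1}u;$$ if $\gamma(G)\le 0$, then $\Gamma_S$ is an $M$-matrix for every nonempty $S\subseteq[s]$, while if $\gamma(G)\ge 0$, then $(\Gamma^{-1})_S$ is an $M$-matrix for every nonempty $S\subseteq[s]$.
   Context: Vectors are column vectors and $'$ denotes transpose. $[k]=\{1,\ldots,k\}$ and $a^{\underline{q}}=a(a-1)\cdots(a-q+1)$ is the falling factorial; $\mathbf{c}^{\underline{2}}=(c_1^{\underline{2}},\ldots,c_s^{\underline{2}})'$. A coloring of $[n]$ with profile $\mathbf{c}=(c_1,\ldots,c_s)$ (positive integers with $c_1+\cdots+c_s=n$) is a map $g:[n]\to[s]$ with $|g^{-1}(i)|=c_i$ for every $i$. The random coloring model is the set $\Phi_{\mathbf{c}}$ of all such colorings with the uniform probability measure $\mathbb{P}_{\mathbf{c}}$ (each coloring has probability $c_1!\cdots c_s!/n!$), with $G$ fixed. $\pi_3(G)$ is the number of copies of the path on three vertices in $G$, i.e. the number of unordered pairs of distinct edges sharing exactly one vertex. The parameter $\gamma(G)$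 is $$\gamma(G)=\frac{2}{n^{\underline{4}}}\left\{\binom{m}{2}-\pi_3(G)\right\}-\left(\frac{m}{n^{\underline{2}}}\right)^2$$ (the formula presupposes $n\ge 4$). $\sigma_i^2$ is the variance of $M_i$, which is given by $$\sigma_i^2=m\frac{c_i^{\underline{2}}}{n^{\underline{2}}}\left(1-m\frac{c_i^{\underline{2}}}{n^{\underline{2}}}\right)+2\left\{\left(\frac{c_i^{\underline{3}}}{n^{\underline{3}}}-\frac{c_i^{\underline{4}}}{n^{\underline{4}}}\right)\pi_3(G)+\frac{c_i^{\underline{4}}}{n^{\underline{4}}}\binom{m}{2}\right\}.$$ For a square matrix $A$ indexed by $[s]$ and nonempty $S\subseteq[s]$, $A_S$ is the principal submatrix of $A$ with rows and columns in $S$. A $Z$-matrix is a real square matrix whose off-diagonal entries are nonpositive; an $M$-matrix is a nonsingular $Z$-matrix whose real eigenvalues are positive.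
   Formalization: For Q invertible, Σ is invertible iff 1+γa'Qa≠0, and the inverse formula assumes this; (ii) assumes Σ invertible and, for γ≥0, also s≤2 or all q_i≥0; likewise for Γ with Q̃. As stated these fail: K_{1,5}, c=(3,3) has Σ singular; C_9, c=(5,2,2) has Σ^{-1} not a Z-matrix. *)

theory Defs
  imports
    "HOL-Probability.Probability_Mass_Function"
    "Jordan_Normal_Form.Char_Poly"
    "Jordan_Normal_Form.Gauss_Jordan_Elimination"
    "Jordan_Normal_Form.DL_Submatrix"
begin

text \<open>
  Matrices and vectors are those of Jordan_Normal_Form and hence indexed from 0. The set of
  colours is therefore \<open>{..<s}\<close> instead of \<open>{1..s}\<close>; the vertex set is \<open>{1..n}\<close>.
\<close>

subsection \<open>Graphs\<close>

definition simple_graph :: "nat \<Rightarrow> nat set set \<Rightarrow> bool" where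
  "simple_graph n E \<longleftrightarrow> (\<forall>e\<in>E. e \<subseteq> {1..n} \<and> card e = 2)"

definition pi3 :: "nat set set \<Rightarrow> nat" where
  "pi3 E = card {P. P \<subseteq> E \<and> card P = 2 \<and> card (\<Inter>P) = 1}"

definition ffact :: "nat \<Rightarrow> nat \<Rightarrow> real" where
  "ffact a q = (\<Prod>k<q. real a - real k)"

definition gamma_graph :: "nat \<Rightarrow> nat set set \<Rightarrow> real" where
  "gamma_graph n E =
     2 / ffact n 4 * (real (card E choose 2) - real (pi3 E)) - (real (card E) / ffact n 2)\<^sup>2"

subsection \<open>The random coloring model\<close>

definition is_profile :: "nat \<Rightarrow> nat \<Rightarrow> (nat \<Rightarrow> nat) \<Rightarrow> bool" where
  "is_profile n s c \<longleftrightarrow> (\<forall>i<s. 0 < c i) \<and> (\<Sum>i<s. c i) = n"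

definition colorings :: "nat \<Rightarrow> nat \<Rightarrow> (nat \<Rightarrow> nat) \<Rightarrow> (nat \<Rightarrow> nat) set" where
  "colorings n s c = {g \<in> {1..n} \<rightarrow>\<^sub>E {..<s}. \<forall>i<s. card {v \<in> {1..n}. g v = i} = c i}"

definition random_coloring :: "nat \<Rightarrow> nat \<Rightarrow> (nat \<Rightarrow> nat) \<Rightarrow> (nat \<Rightarrow> nat) pmf" where
  "random_coloring n s c = pmf_of_set (colorings n s c)"

definition mono_edges :: "nat set set \<Rightarrow> nat \<Rightarrow> (nat \<Rightarrow> nat) \<Rightarrow> real" where
  "mono_edges E i g = real (card {e \<in> E. \<forall>v\<in>e. g v = i})"

definition covariance :: "'a pmf \<Rightarrow> ('a \<Rightarrow> real) \<Rightarrow> ('a \<Rightarrow> real) \<Rightarrow> real" where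
  "covariance p X Y = measure_pmf.expectation p
     (\<lambda>\<omega>. (X \<omega> - measure_pmf.expectation p X) * (Y \<omega> - measure_pmf.expectation p Y))"

definition sigma_sq :: "nat \<Rightarrow> nat \<Rightarrow> (nat \<Rightarrow> nat) \<Rightarrow> nat set set \<Rightarrow> nat \<Rightarrow> real" where
  "sigma_sq n s c E i = measure_pmf.variance (random_coloring n s c) (mono_edges E i)"

definition cov_mat :: "nat \<Rightarrow> nat \<Rightarrow> (nat \<Rightarrow> nat) \<Rightarrow> nat set set \<Rightarrow> real mat" where
  "cov_mat n s c E = Matrix.mat s s
     (\<lambda>(i, j). covariance (random_coloring n s c) (mono_edges E i) (mono_edges E j))"

definition ff2_vec :: "nat \<Rightarrow> (nat \<Rightarrow> nat) \<Rightarrow> real Matrix.vec" where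
  "ff2_vec s c = Matrix.vec s (\<lambda>i. ffact (c i) 2)"

definition q_entry :: "nat \<Rightarrow> nat \<Rightarrow> (nat \<Rightarrow> nat) \<Rightarrow> nat set set \<Rightarrow> nat \<Rightarrow> real" where
  "q_entry n s c E i = sigma_sq n s c E i - gamma_graph n E * (ffact (c i) 2)\<^sup>2"

text \<open>The matrix \<open>D\<^sup>-\<^sup>1\<^sup>/\<^sup>2\<close>, where \<open>D\<close> is the diagonal matrix of the variances.\<close>

definition D_inv_sqrt :: "nat \<Rightarrow> nat \<Rightarrow> (nat \<Rightarrow> nat) \<Rightarrow> nat set set \<Rightarrow> real mat" where
  "D_inv_sqrt n s c E = mat_diag s (\<lambda>i. 1 / sqrt (sigma_sq n s c E i))"

subsection \<open>Matrices\<close>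

definition outer :: "real Matrix.vec \<Rightarrow> real Matrix.vec \<Rightarrow> real mat" where
  "outer v w = Matrix.mat (dim_vec v) (dim_vec w) (\<lambda>(i, j). vec_index v i * vec_index w j)"

text \<open>Only meaningful for invertible matrices; otherwise \<^const>\<open>mat_inverse\<close> is \<^term>\<open>None\<close>.\<close>

definition minv :: "real mat \<Rightarrow> real mat" where
  "minv A = the (mat_inverse A)"

abbreviation principal_submatrix :: "real mat \<Rightarrow> nat set \<Rightarrow> real mat" where
  "principal_submatrix A S \<equiv> submatrix A S S"

definition Z_matrix :: "real mat \<Rightarrow> bool" where
  "Z_matrix A \<longleftrightarrow>
     square_mat A \<and> (\<forall>i<dim_row A. \<forall>j<dim_col A. i \<noteq> j \<longrightarrow> A $$ (i, j) \<le> 0)"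

text \<open>The eigenvalues of a real matrix in the sense of \<^const>\<open>eigenvalue\<close> are its real ones.\<close>

definition M_matrix :: "real mat \<Rightarrow> bool" where
  "M_matrix A \<longleftrightarrow> Z_matrix A \<and> invertible_mat A \<and> (\<forall>k. eigenvalue A k \<longrightarrow> 0 < k)"

end

(*
  The probability that a partial coloring extends to a random one is a quotient of falling
  factorials; summing over pairs of edges by the size of their intersection gives the covariances,
  which off the diagonal are gamma(G) times a product of falling factorials. So Sigma is a diagonal
  matrix plus gamma(G) x x', and Gamma has the same shape. Both are positive semidefinite, hence
  positive definite when invertible. Principal submatrices and inverses inherit positive
  definiteness, and a positive definite Z-matrix is an M-matrix, so only the signs of the
  off-diagonal entries remain to be found. For the inverse they are read off the linear system
  satisfied by a column.
*)
theory Submission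
  imports Defs
begin

unbundle no vec_syntax
unbundle no inner_syntax

subsection \<open>Moments of the random coloring model\<close>

text \<open>Neither sign of \<open>\<gamma>\<close> makes \<open>Q + \<gamma> x x'\<close> positive
  definite by inspection: for negative \<open>\<gamma>\<close> the rank one part is negative
  semidefinite, and for positive \<open>\<gamma>\<close> some \<open>q_i\<close> may be negative.
  Hence positivity is taken from the probabilistic meaning of the matrix, and invertibility is
  assumed in (ii). It does not follow from that of \<open>Q\<close>. With a single color
  \<open>M\<close> is constant and \<open>\<Sigma>\<close> is zero, yet the only entry
  \<open>-\<gamma> x_0^2\<close> of \<open>Q\<close> is nonzero whenever \<open>\<gamma>\<close> is;
  there \<open>d = 1 + \<gamma> a'Qa\<close> vanishes. So \<open>d\<close> being nonzero is the
  criterion for invertibility. The sign condition on the \<open>q_i\<close> has its source in the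
  off-diagonal entries \<open>-(\<gamma> / d) a_i a_j\<close> of the inverse. If
  \<open>\<gamma>\<close> is positive, \<open>Q\<close> is invertible and some \<open>q_k\<close> is
  negative, then positive definiteness leaves only one such \<open>k\<close> and forces
  \<open>d\<close> to be negative, so the entries at two indices other than \<open>k\<close> get the
  wrong sign; two colors leave no such pair. This formula is not the basis of the sign proof,
  because \<open>Q\<close> can be singular while \<open>\<Sigma>\<close> is not; the linear system
  covers both cases.\<close>

lemma finite_colorings: "finite (colorings n s c)"
proof -
  have "finite ({1..n} \<rightarrow>\<^sub>E {..<s})" by (intro finite_PiE) auto
  thus ?thesis unfolding colorings_def by (rule rev_finite_subset) blast
qed

lemma ffact_0 [simp]: "ffact a 0 = 1"
  by (simp add: ffact_def)

lemma ffact_Suc: "ffact a (Suc q) = ffact a q * (real a - real q)"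
  by (simp add: ffact_def)

lemma ffact_2: "ffact a 2 = real a * (real a - 1)"
  by (simp add: ffact_def numeral_2_eq_2)

lemma ffact_pos: "q \<le> a \<Longrightarrow> ffact a q > 0"
  unfolding ffact_def by (intro prod_pos) auto

lemma ffact_2_nonneg: "ffact a 2 \<ge> 0"
  by (cases a) (auto simp: ffact_2)

text \<open>The transposition is an involution of the vertex set, so it matches the color classes
  before and after. It fixes all other points, so the value \<open>undefined\<close> demanded there
  by the extensional function space survives.\<close>

lemma comp_transpose_in_colorings:
  assumes g: "g \<in> colorings n s c" and v: "v \<in> {1..n}" and w: "w \<in> {1..n}"
  shows "g \<circ> Transposition.transpose v w \<in> colorings n s c"
proof -
  let ?t = "Transposition.transpose v w"
  have t: "?t u \<in> {1..n} \<longleftrightarrow> u \<in> {1..n}" for u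
    using v w by (auto simp: Transposition.transpose_def)
  have "g \<circ> ?t \<in> {1..n} \<rightarrow>\<^sub>E {..<s}"
  proof (rule PiE_I)
    fix u assume "u \<in> {1..n}"
    hence "?t u \<in> {1..n}" using t by blast
    thus "(g \<circ> ?t) u \<in> {..<s}" using g unfolding colorings_def by auto
  next
    fix u assume u: "u \<notin> {1..n}"
    hence "?t u \<notin> {1..n}" using t by blast
    hence "g (?t u) = undefined" using g by (auto simp: colorings_def PiE_def extensional_def)
    thus "(g \<circ> ?t) u = undefined" by simp
  qed
  moreover have "card {u \<in> {1..n}. (g \<circ> ?t) u = i} = c i" if i: "i < s" for i
  proof -
    have "bij_betw ?t {u \<in> {1..n}. (g \<circ> ?t) u = i} {u \<in> {1..n}. g u = i}"
      using t by (intro bij_betw_byWitness[where f' = ?t]) (simp_all del: atLeastAtMost_iff add: image_subset_iff)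
    hence "card {u \<in> {1..n}. (g \<circ> ?t) u = i} = card {u \<in> {1..n}. g u = i}"
      by (rule bij_betw_same_card)
    thus ?thesis using g i by (simp add: colorings_def)
  qed
  ultimately show ?thesis unfolding colorings_def by simp
qed

text \<open>
  Transposing two vertices outside \<open>T\<close> permutes the colorings that agree with \<open>h\<close> on \<open>T\<close>, so the
  number of those that give a new vertex a prescribed color does not depend on the vertex.
\<close>

lemma card_colorings_agree:
  assumes "T \<subseteq> {1..n}" and "h \<in> T \<rightarrow> {..<s}"
  shows "real (card {g \<in> colorings n s c. \<forall>v\<in>T. g v = h v}) * ffact n (card T) =
    real (card (colorings n s c)) * (\<Prod>k<s. ffact (c k) (card {v \<in> T. h v = k}))"
proof -
  have "finite T" using assms(1) by (rule finite_subset) simp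
  thus ?thesis using assms
  proof (induction T)
    case empty
    show ?case by simp
  next
    case (insert v T)
    define A where "A = {g \<in> colorings n s c. \<forall>u\<in>T. g u = h u}"
    define k where "k = h v"
    have T: "T \<subseteq> {1..n}" and v: "v \<in> {1..n}" and k: "k < s" and h: "h \<in> T \<rightarrow> {..<s}"
      using insert.prems by (auto simp: k_def)
    have finA: "finite A" unfolding A_def using finite_colorings by simp
    define N where "N w = card {g \<in> A. g w = k}" for w
    have N_eq: "N w = N v" if w: "w \<in> {1..n} - T" for w
    proof -
      let ?f = "\<lambda>g. g \<circ> Transposition.transpose v w"
      have A: "?f g \<in> A" if "g \<in> A" for g
        using that comp_transpose_in_colorings[of g n s c v w] v w insert.hyps(2)
        by (auto simp: A_def Transposition.transpose_def)
      have ff: "?f (?f g) = g" for g by (simp add: fun_eq_iff)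
      have "bij_betw ?f {g \<in> A. g w = k} {g \<in> A. g v = k}"
      proof (rule bij_betw_byWitness[where f' = ?f])
        show "?f ` {g \<in> A. g w = k} \<subseteq> {g \<in> A. g v = k}"
          using A by auto
        show "?f ` {g \<in> A. g v = k} \<subseteq> {g \<in> A. g w = k}"
          using A by auto
      qed (intro ballI ff)+
      thus ?thesis unfolding N_def by (rule bij_betw_same_card)
    qed
    have cnt: "card {w \<in> {1..n} - T. g w = k} = c k - card {u \<in> T. h u = k}"
      and le: "card {u \<in> T. h u = k} \<le> c k" if g: "g \<in> A" for g
    proof -
      have "{w \<in> {1..n} - T. g w = k} = {w \<in> {1..n}. g w = k} - {u \<in> T. h u = k}"
        using g by (auto simp: A_def)
      moreover have sub: "{u \<in> T. h u = k} \<subseteq> {w \<in> {1..n}. g w = k}"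
        using g T by (auto simp: A_def)
      moreover have ck: "card {w \<in> {1..n}. g w = k} = c k"
        using g k by (auto simp: A_def colorings_def)
      moreover have "finite {u \<in> T. h u = k}" using insert.hyps(1) by simp
      ultimately show "card {w \<in> {1..n} - T. g w = k} = c k - card {u \<in> T. h u = k}"
        by (simp only: card_Diff_subset)
      have "card {u \<in> T. h u = k} \<le> card {w \<in> {1..n}. g w = k}"
        using sub by (intro card_mono) auto
      thus "card {u \<in> T. h u = k} \<le> c k" using ck by simp
    qed
    \<comment> \<open>Double counting of the pairs of a vertex \<open>w\<close> outside
      \<open>T\<close> and a coloring \<open>g\<close> in \<open>A\<close> with
      \<open>g w = k\<close>: every \<open>g\<close> has the same number of such vertices, because
      its values on \<open>T\<close> are prescribed.\<close>
    have "(\<Sum>w\<in>{1..n} - T. N w) = (\<Sum>g\<in>A. c k - card {u \<in> T. h u = k})"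
      unfolding N_def by (rule sum_multicount_gen[OF _ finA]) (use cnt in blast)+
    moreover have "(\<Sum>w\<in>{1..n} - T. N w) = (n - card T) * N v"
      using N_eq T insert.hyps(1) by (simp add: card_Diff_subset)
    ultimately have eq: "(n - card T) * N v = card A * (c k - card {u \<in> T. h u = k})"
      by simp
    have "card (insert v T) \<le> n"
      using card_mono[OF _ insert.prems(1)] by simp
    hence cT: "card T < n" using insert.hyps by simp
    \<comment> \<open>The natural subtraction on the right of \<open>eq\<close> can truncate only if
      \<open>A\<close> is empty, and then both sides vanish. Hence the identity passes to the
      reals.\<close>
    have eqr: "(real n - real (card T)) * real (N v)
        = real (card A) * (real (c k) - real (card {u \<in> T. h u = k}))"
    proof (cases "A = {}")
      case True
      thus ?thesis using eq cT by (simp add: N_def)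
    next
      case False
      hence "card {u \<in> T. h u = k} \<le> c k" using le by blast
      thus ?thesis using arg_cong[OF eq, of real] cT by (simp add: of_nat_diff)
    qed
    have "{g \<in> colorings n s c. \<forall>u\<in>insert v T. g u = h u} = {g \<in> A. g v = k}"
      by (auto simp: A_def k_def)
    hence L: "real (card {g \<in> colorings n s c. \<forall>u\<in>insert v T. g u = h u}) = real (N v)"
      by (simp add: N_def)
    have cset: "card {u \<in> insert v T. h u = j}
        = (if j = k then Suc (card {u \<in> T. h u = j}) else card {u \<in> T. h u = j})" for j
    proof (cases "j = k")
      case True
      hence "{u \<in> insert v T. h u = j} = insert v {u \<in> T. h u = j}" by (auto simp: k_def)
      thus ?thesis using True insert.hyps by simp
    next
      case False
      hence "{u \<in> insert v T. h u = j} = {u \<in> T. h u = j}" by (auto simp: k_def)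
      thus ?thesis using False by simp
    qed
    \<comment> \<open>Only the class of the color \<open>k\<close> grows, by one vertex, so its
      falling factorial gains precisely the factor on the right of \<open>eqr\<close>.\<close>
    have P: "(\<Prod>j<s. ffact (c j) (card {u \<in> insert v T. h u = j})) =
        (\<Prod>j<s. ffact (c j) (card {u \<in> T. h u = j})) * (real (c k) - real (card {u \<in> T. h u = k}))"
    proof -
      have kin: "k \<in> {..<s}" using k by simp
      have r: "(\<Prod>j\<in>{..<s} - {k}. ffact (c j) (card {u \<in> insert v T. h u = j})) =
        (\<Prod>j\<in>{..<s} - {k}. ffact (c j) (card {u \<in> T. h u = j}))"
        by (intro prod.cong) (auto simp: cset simp del: insert_iff)
      show ?thesis
        unfolding prod.remove[OF finite_lessThan kin] r
        by (simp add: cset ffact_Suc del: insert_iff)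
    qed
    have IH: "real (card A) * ffact n (card T)
        = real (card (colorings n s c)) * (\<Prod>j<s. ffact (c j) (card {u \<in> T. h u = j}))"
      unfolding A_def by (rule insert.IH[OF T h])
    have "real (N v) * ffact n (card (insert v T))
        = ffact n (card T) * ((real n - real (card T)) * real (N v))"
      using insert.hyps by (simp add: ffact_Suc)
    also have "\<dots> = real (card A) * ffact n (card T) * (real (c k) - real (card {u \<in> T. h u = k}))"
      unfolding eqr by simp
    finally show ?case unfolding L P IH by simp
  qed
qed

text \<open>For a constant prescription on \<open>T\<close> every factor of the product over the
  colors is one, except that of \<open>i\<close>.\<close>

lemma prob_monochromatic:
  assumes C: "colorings n s c \<noteq> {}" and T: "T \<subseteq> {1..n}" and i: "i < s"
  shows "(\<Sum>g\<in>colorings n s c. of_bool (\<forall>v\<in>T. g v = i)) / card (colorings n s c)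
    = ffact (c i) (card T) / ffact n (card T)"
proof -
  have "card T \<le> n" using card_mono[OF _ T] by simp
  hence pos: "ffact n (card T) > 0" by (rule ffact_pos)
  have C0: "card (colorings n s c) > 0" using C finite_colorings by (simp add: card_gt_0_iff)
  have "(\<Prod>k<s. ffact (c k) (card {v \<in> T. i = k})) = (\<Prod>k<s. if k = i then ffact (c i) (card T) else 1)"
    by (intro prod.cong) auto
  also have "\<dots> = ffact (c i) (card T)" using i by simp
  finally have "real (card {g \<in> colorings n s c. \<forall>v\<in>T. g v = i}) * ffact n (card T) =
    real (card (colorings n s c)) * ffact (c i) (card T)"
    using card_colorings_agree[OF T, of "\<lambda>_. i" s c] i by auto
  moreover have "(\<Sum>g\<in>colorings n s c. of_bool (\<forall>v\<in>T. g v = i))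
      = real (card {g \<in> colorings n s c. \<forall>v\<in>T. g v = i})"
    using finite_colorings by (simp add: of_bool_def sum.If_cases Int_def conj_commute)
  ultimately show ?thesis using pos C0 by (simp add: field_simps)
qed

text \<open>By disjointness the two constant prescriptions merge into a single one on
  \<open>T \<union> U\<close>, whose product over the colors has just two nontrivial
  factors.\<close>

lemma prob_two_colors:
  assumes C: "colorings n s c \<noteq> {}" and T: "T \<subseteq> {1..n}" and U: "U \<subseteq> {1..n}"
    and TU: "T \<inter> U = {}" and i: "i < s" and j: "j < s" and ij: "i \<noteq> j"
  shows "(\<Sum>g\<in>colorings n s c. of_bool (\<forall>v\<in>T. g v = i) * of_bool (\<forall>v\<in>U. g v = j))
      / card (colorings n s c)
    = ffact (c i) (card T) * ffact (c j) (card U) / ffact n (card T + card U)"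
proof -
  define h where "h v = (if v \<in> T then i else j)" for v
  have fin: "finite T" "finite U" using T U finite_subset by blast+
  have card: "card (T \<union> U) = card T + card U" using fin TU by (rule card_Un_disjoint)
  have "card (T \<union> U) \<le> n" using card_mono[of "{1..n}" "T \<union> U"] T U by simp
  hence pos: "ffact n (card T + card U) > 0" using card by (simp add: ffact_pos)
  have C0: "card (colorings n s c) > 0" using C finite_colorings by (simp add: card_gt_0_iff)
  have "{v \<in> T \<union> U. h v = k} = (if k = i then T else if k = j then U else {})" for k
    using TU ij by (auto simp: h_def)
  hence "(\<Prod>k<s. ffact (c k) (card {v \<in> T \<union> U. h v = k})) =
      (\<Prod>k<s. (if k = i then ffact (c i) (card T) else 1) * (if k = j then ffact (c j) (card U) else 1))"
    using ij by (intro prod.cong) auto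
  also have "\<dots> = ffact (c i) (card T) * ffact (c j) (card U)"
    unfolding prod.distrib using i j by simp
  finally have "real (card {g \<in> colorings n s c. \<forall>v\<in>T \<union> U. g v = h v}) * ffact n (card T + card U) =
    real (card (colorings n s c)) * (ffact (c i) (card T) * ffact (c j) (card U))"
    using card_colorings_agree[of "T \<union> U" n h s c] T U i j card by (simp add: h_def)
  moreover have "{g \<in> colorings n s c. \<forall>v\<in>T \<union> U. g v = h v}
      = {g \<in> colorings n s c. (\<forall>v\<in>T. g v = i) \<and> (\<forall>v\<in>U. g v = j)}"
    using TU by (auto simp: h_def)
  moreover have "(\<Sum>g\<in>colorings n s c. of_bool (\<forall>v\<in>T. g v = i) * of_bool (\<forall>v\<in>U. g v = j))
      = real (card {g \<in> colorings n s c. (\<forall>v\<in>T. g v = i) \<and> (\<forall>v\<in>U. g v = j)})"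
    using finite_colorings
    unfolding of_bool_conj[symmetric]
    by (simp add: of_bool_def sum.If_cases Int_def conj_commute)
  ultimately show ?thesis using pos C0 by (simp add: field_simps)
qed

text \<open>Two edges meet in 2, 1 or 0 vertices. The ordered pairs of the first kind are the pairs
  \<open>(e, e)\<close>, those of the second are the two orders of each path counted by
  \<open>pi3\<close>, and the disjoint ones are what remains.\<close>

lemma sum_pairs_of_edges:
  fixes F :: "nat \<Rightarrow> real"
  assumes fin: "finite E" and E: "\<And>e. e \<in> E \<Longrightarrow> finite e \<and> card e = 2"
  shows "(\<Sum>e\<in>E. \<Sum>e'\<in>E. F (card (e \<inter> e'))) = real (card E) * F 2 + 2 * real (pi3 E) * F 1
    + 2 * (real (card E choose 2) - real (pi3 E)) * F 0"
proof -
  define P where "P k = {p \<in> E \<times> E. card (fst p \<inter> snd p) = k}" for k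
  have expand: "(\<Sum>e\<in>E. \<Sum>e'\<in>E. G (card (e \<inter> e')))
      = real (card (P 0)) * G 0 + real (card (P 1)) * G 1 + real (card (P 2)) * G 2"
    for G :: "nat \<Rightarrow> real"
  proof -
    have le: "card (e \<inter> e') \<in> {0, 1, 2}" if "e \<in> E" for e e'
    proof -
      have "card (e \<inter> e') \<le> 2" using card_mono[of e "e \<inter> e'"] E[OF that] by auto
      thus ?thesis by (metis One_nat_def insertCI le_Suc_eq le_zero_eq numeral_2_eq_2)
    qed
    have "(\<Sum>e\<in>E. \<Sum>e'\<in>E. G (card (e \<inter> e'))) = (\<Sum>p\<in>E \<times> E. G (card (fst p \<inter> snd p)))"
      by (simp add: sum.cartesian_product case_prod_unfold)
    also have "\<dots> = (\<Sum>k\<in>{0, 1, 2}. \<Sum>p | p \<in> E \<times> E \<and> card (fst p \<inter> snd p) = k. G (card (fst p \<inter> snd p)))"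
      using fin le by (intro sum.group[symmetric]) (force simp del: card_0_eq)+
    also have "\<dots> = (\<Sum>k\<in>{0, 1, 2}. real (card (P k)) * G k)"
      by (intro sum.cong refl) (auto simp: P_def)
    finally show ?thesis by simp
  qed
  have eq: "e = e'" if "e \<in> E" "e' \<in> E" "card (e \<inter> e') = 2" for e e'
    using that E card_subset_eq[of e "e \<inter> e'"] card_subset_eq[of e' "e \<inter> e'"] by auto
  have "P 2 = (\<lambda>e. (e, e)) ` E"
    using E eq by (force simp: P_def)
  hence P2: "card (P 2) = card E" by (simp add: card_image inj_on_def)
  define R where "R = {p. p \<subseteq> E \<and> card p = 2 \<and> card (\<Inter>p) = 1}"
  have finR: "finite R"
    unfolding R_def using fin by (auto intro: rev_finite_subset[of "Pow E"])
  have "P 1 = (\<Union>p\<in>R. {(e, e'). {e, e'} = p})"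
  proof (intro equalityI subsetI)
    fix q assume q: "q \<in> P 1"
    obtain e e' where [simp]: "q = (e, e')" by (cases q)
    have "e \<noteq> e'" using q E[of e] by (auto simp: P_def)
    hence "{e, e'} \<in> R" using q by (auto simp: P_def R_def)
    thus "q \<in> (\<Union>p\<in>R. {(e, e'). {e, e'} = p})" by auto
  next
    fix q assume "q \<in> (\<Union>p\<in>R. {(e, e'). {e, e'} = p})"
    then obtain e e' where q: "q = (e, e')" and "{e, e'} \<in> R" by auto
    hence "e \<in> E \<and> e' \<in> E \<and> card (e \<inter> e') = 1" by (simp add: R_def)
    thus "q \<in> P 1" using q by (simp add: P_def)
  qed
  moreover have cp: "card {(e, e'). {e, e'} = p} = 2 \<and> finite {(e, e'). {e, e'} = p}" if "p \<in> R" for p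
  proof -
    have "card p = 2" using that by (simp add: R_def)
    then obtain a b where ab: "p = {a, b}" "a \<noteq> b" by (meson card_2_iff)
    hence "{(e, e'). {e, e'} = p} = {(a, b), (b, a)}" by (auto simp: doubleton_eq_iff)
    thus ?thesis using ab by simp
  qed
  moreover have "card (\<Union>p\<in>R. {(e, e'). {e, e'} = p}) = (\<Sum>p\<in>R. card {(e, e'). {e, e'} = p})"
    using finR cp by (intro card_UN_disjoint) auto
  ultimately have P1: "card (P 1) = 2 * pi3 E"
    by (simp add: pi3_def R_def)
  \<comment> \<open>The constant function one counts all ordered pairs, which yields the number of
    disjoint ones by subtraction.\<close>
  have "real (card E) * real (card E) = real (card (P 0)) + real (card (P 1)) + real (card (P 2))"
    using expand[of "\<lambda>_. 1"] by simp
  moreover have "2 * real (card E choose 2) = real (card E) * (real (card E) - 1)"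
    by (simp add: binomial_gbinomial gbinomial_prod_rev numeral_2_eq_2 field_simps)
  ultimately have "real (card (P 0)) = 2 * (real (card E choose 2) - real (pi3 E))"
    using P1 P2 by (simp add: algebra_simps)
  thus ?thesis using expand[of F] P1 P2 by simp
qed

section \<open>First and second moments of the monochromatic edge counts\<close>

lemma covariance_eq:
  assumes fin: "finite (set_pmf p)"
  shows "covariance p X Y = measure_pmf.expectation p (\<lambda>\<omega>. X \<omega> * Y \<omega>)
    - measure_pmf.expectation p X * measure_pmf.expectation p Y"
proof -
  have [simp]: "integrable (measure_pmf p) h" for h :: "'a \<Rightarrow> real"
    using fin by (rule integrable_measure_pmf_finite)
  define \<mu> \<nu> where "\<mu> = measure_pmf.expectation p X" and "\<nu> = measure_pmf.expectation p Y"
  have "(\<lambda>\<omega>. (X \<omega> - \<mu>) * (Y \<omega> - \<nu>)) = (\<lambda>\<omega>. (X \<omega> * Y \<omega> - \<mu> * Y \<omega>) - (\<nu> * X \<omega> - \<mu> * \<nu>))"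
    by (auto simp: algebra_simps)
  thus ?thesis unfolding covariance_def \<mu>_def[symmetric] \<nu>_def[symmetric]
    by (simp add: \<mu>_def[symmetric] \<nu>_def[symmetric])
qed

lemma variance_eq_covariance: "measure_pmf.variance p X = covariance p X X"
  by (simp add: covariance_def power2_eq_square)

lemma mono_edges_eq_sum:
  assumes "finite E"
  shows "mono_edges E i g = (\<Sum>e\<in>E. of_bool (\<forall>v\<in>e. g v = i))"
  using assms by (simp add: mono_edges_def of_bool_def sum.If_cases Int_def)

context
  fixes n s :: nat and c :: "nat \<Rightarrow> nat" and E :: "nat set set"
  assumes graph: "simple_graph n E" and nonempty: "colorings n s c \<noteq> {}"
begin

lemma finite_edges: "finite E"
proof -
  have "E \<subseteq> Pow {1..n}" using graph by (auto simp: simple_graph_def)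
  thus ?thesis by (rule finite_subset) simp
qed

lemma edge_card: "e \<in> E \<Longrightarrow> e \<subseteq> {1..n} \<and> finite e \<and> card e = 2"
  using graph by (auto simp: simple_graph_def intro: finite_subset)

lemma expectation_random_coloring:
  "measure_pmf.expectation (random_coloring n s c) F
    = (\<Sum>g\<in>colorings n s c. F g) / card (colorings n s c)"
  unfolding random_coloring_def by (rule integral_pmf_of_set[OF nonempty finite_colorings])

lemma expectation_mono_edges:
  assumes i: "i < s"
  shows "measure_pmf.expectation (random_coloring n s c) (mono_edges E i)
    = real (card E) * (ffact (c i) 2 / ffact n 2)"
proof -
  have "measure_pmf.expectation (random_coloring n s c) (mono_edges E i)
      = (\<Sum>e\<in>E. (\<Sum>g\<in>colorings n s c. of_bool (\<forall>v\<in>e. g v = i)) / card (colorings n s c))"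
    unfolding expectation_random_coloring mono_edges_eq_sum[OF finite_edges]
    by (subst sum.swap) (simp add: sum_divide_distrib)
  also have "\<dots> = (\<Sum>e\<in>E. ffact (c i) 2 / ffact n 2)"
    using prob_monochromatic[OF nonempty _ i] edge_card by (intro sum.cong) auto
  finally show ?thesis by simp
qed

lemma expectation_mono_edges_mult:
  "measure_pmf.expectation (random_coloring n s c) (\<lambda>g. mono_edges E i g * mono_edges E j g)
    = (\<Sum>e\<in>E. \<Sum>e'\<in>E. (\<Sum>g\<in>colorings n s c. of_bool (\<forall>v\<in>e. g v = i) * of_bool (\<forall>v\<in>e'. g v = j))
        / card (colorings n s c))"
proof -
  define F where "F e e' g = of_bool (\<forall>v\<in>e. g v = i) * (of_bool (\<forall>v\<in>e'. g v = j) :: real)"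
    for e e' :: "nat set" and g :: "nat \<Rightarrow> nat"
  have "(\<Sum>g\<in>colorings n s c. \<Sum>e\<in>E. \<Sum>e'\<in>E. F e e' g)
      = (\<Sum>e\<in>E. \<Sum>g\<in>colorings n s c. \<Sum>e'\<in>E. F e e' g)"
    by (rule sum.swap)
  also have "\<dots> = (\<Sum>e\<in>E. \<Sum>e'\<in>E. \<Sum>g\<in>colorings n s c. F e e' g)"
    by (rule sum.cong[OF refl], rule sum.swap)
  finally show ?thesis
    unfolding expectation_random_coloring mono_edges_eq_sum[OF finite_edges] sum_product
      F_def[symmetric]
    by (simp add: sum_divide_distrib)
qed

text \<open>Two edges both have color \<open>i\<close> if and only if their union is monochromatic,
  and this union has \<open>4 - card (e \<inter> e')\<close> vertices. So the contribution of a pair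
  depends on the size of its intersection alone.\<close>

lemma covariance_mono_edges_same:
  assumes i: "i < s"
  shows "covariance (random_coloring n s c) (mono_edges E i) (mono_edges E i) =
    real (card E) * (ffact (c i) 2 / ffact n 2) * (1 - real (card E) * (ffact (c i) 2 / ffact n 2))
    + 2 * ((ffact (c i) 3 / ffact n 3 - ffact (c i) 4 / ffact n 4) * real (pi3 E)
           + ffact (c i) 4 / ffact n 4 * real (card E choose 2))"
proof -
  have "measure_pmf.expectation (random_coloring n s c) (\<lambda>g. mono_edges E i g * mono_edges E i g)
      = (\<Sum>e\<in>E. \<Sum>e'\<in>E. (\<lambda>k. ffact (c i) (4 - k) / ffact n (4 - k)) (card (e \<inter> e')))"
    unfolding expectation_mono_edges_mult
  proof (intro sum.cong refl)
    fix e e' assume e: "e \<in> E" "e' \<in> E"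
    have "card (e \<union> e') = 4 - card (e \<inter> e')"
      using card_Un_Int[of e e'] edge_card e by simp
    moreover have "e \<union> e' \<subseteq> {1..n}" using edge_card e by auto
    ultimately show "(\<Sum>g\<in>colorings n s c. of_bool (\<forall>v\<in>e. g v = i) * of_bool (\<forall>v\<in>e'. g v = i))
        / card (colorings n s c) = ffact (c i) (4 - card (e \<inter> e')) / ffact n (4 - card (e \<inter> e'))"
      using prob_monochromatic[OF nonempty _ i, of "e \<union> e'"]
      by (simp add: ball_Un flip: of_bool_conj)
  qed
  also have "\<dots> = real (card E) * (ffact (c i) 2 / ffact n 2)
      + 2 * real (pi3 E) * (ffact (c i) 3 / ffact n 3)
      + 2 * (real (card E choose 2) - real (pi3 E)) * (ffact (c i) 4 / ffact n 4)"
    using edge_card by (subst sum_pairs_of_edges[OF finite_edges]) auto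
  finally have X: "measure_pmf.expectation (random_coloring n s c) (\<lambda>g. mono_edges E i g * mono_edges E i g) = \<dots>" .
  have fin: "finite (set_pmf (random_coloring n s c))"
    using nonempty finite_colorings by (simp add: random_coloring_def)
  show ?thesis
    unfolding covariance_eq[OF fin] X expectation_mono_edges[OF i]
    by (simp add: algebra_simps)
qed

text \<open>Edges with a common vertex cannot carry different colors, so only the disjoint ordered
  pairs enter the mixed moment. The factor depending on the colors splits off from this moment and
  from the product of the means; what is left is the graph parameter, with the product of the means
  supplying its squared term.\<close>

lemma covariance_mono_edges_distinct:
  assumes i: "i < s" and j: "j < s" and ij: "i \<noteq> j"
  shows "covariance (random_coloring n s c) (mono_edges E i) (mono_edges E j) =
    gamma_graph n E * (ffact (c i) 2 * ffact (c j) 2)"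
proof -
  have "measure_pmf.expectation (random_coloring n s c) (\<lambda>g. mono_edges E i g * mono_edges E j g)
      = (\<Sum>e\<in>E. \<Sum>e'\<in>E. (\<lambda>k. if k = 0 then ffact (c i) 2 * ffact (c j) 2 / ffact n 4 else 0)
            (card (e \<inter> e')))"
    unfolding expectation_mono_edges_mult
  proof (intro sum.cong refl)
    fix e e' assume e: "e \<in> E" "e' \<in> E"
    show "(\<Sum>g\<in>colorings n s c. of_bool (\<forall>v\<in>e. g v = i) * of_bool (\<forall>v\<in>e'. g v = j))
        / card (colorings n s c)
      = (if card (e \<inter> e') = 0 then ffact (c i) 2 * ffact (c j) 2 / ffact n 4 else 0)"
    proof (cases "e \<inter> e' = {}")
      case True
      thus ?thesis using prob_two_colors[OF nonempty _ _ True i j ij] e edge_card by simp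
    next
      case False
      then obtain v where "v \<in> e" "v \<in> e'" by blast
      hence "((\<forall>v\<in>e. g v = i) \<and> (\<forall>v\<in>e'. g v = j)) \<longleftrightarrow> False" for g using ij by metis
      thus ?thesis using False e edge_card unfolding of_bool_conj[symmetric] by (simp only: of_bool_eq) simp
    qed
  qed
  also have "\<dots> = 2 * (real (card E choose 2) - real (pi3 E)) * (ffact (c i) 2 * ffact (c j) 2 / ffact n 4)"
    using edge_card by (subst sum_pairs_of_edges[OF finite_edges]) auto
  finally have X: "measure_pmf.expectation (random_coloring n s c) (\<lambda>g. mono_edges E i g * mono_edges E j g) = \<dots>" .
  have fin: "finite (set_pmf (random_coloring n s c))"
    using nonempty finite_colorings by (simp add: random_coloring_def)
  show ?thesis
    unfolding covariance_eq[OF fin] X expectation_mono_edges[OF i] expectation_mono_edges[OF j]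
      gamma_graph_def
    by (simp add: algebra_simps power2_eq_square diff_divide_distrib)
qed

text \<open>The double sum is the variance of the linear combination of the counts with weights
  \<open>w\<close>.\<close>

lemma covariance_mono_edges_psd:
  "(\<Sum>i<s. \<Sum>j<s. w i * w j * covariance (random_coloring n s c) (mono_edges E i) (mono_edges E j)) \<ge> 0"
proof -
  let ?p = "random_coloring n s c"
  have "finite (set_pmf ?p)"
    using nonempty finite_colorings by (simp add: random_coloring_def)
  hence int [simp]: "integrable (measure_pmf ?p) h" for h :: "_ \<Rightarrow> real"
    by (rule integrable_measure_pmf_finite)
  define Y where "Y i g = mono_edges E i g - measure_pmf.expectation ?p (mono_edges E i)" for i g
  have "(\<Sum>i<s. \<Sum>j<s. w i * w j * covariance ?p (mono_edges E i) (mono_edges E j))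
      = measure_pmf.expectation ?p (\<lambda>g. \<Sum>i<s. \<Sum>j<s. w i * w j * (Y i g * Y j g))"
    by (simp add: covariance_def Y_def)
  also have "(\<lambda>g. \<Sum>i<s. \<Sum>j<s. w i * w j * (Y i g * Y j g)) = (\<lambda>g. (\<Sum>i<s. w i * Y i g)\<^sup>2)"
    by (simp add: power2_eq_square sum_product mult_ac)
  also have "measure_pmf.expectation ?p (\<lambda>g. (\<Sum>i<s. w i * Y i g)\<^sup>2) \<ge> 0"
    by (rule integral_nonneg_AE) simp
  finally show ?thesis .
qed

end

subsection \<open>Positive definite matrices and rank one updates\<close>

text \<open>\<open>invertible_mat\<close> asks for an inverse of unspecified dimensions, which are
  read off the two identities here. The determinant then serves as the link to the kernel and to
  \<open>mat_inverse\<close>.\<close>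

lemma invertible_mat_iff_det:
  fixes A :: "'a :: field mat"
  assumes A: "A \<in> carrier_mat n n"
  shows "invertible_mat A \<longleftrightarrow> det A \<noteq> 0"
proof
  assume "invertible_mat A"
  then obtain B where AB: "A * B = 1\<^sub>m n" and BA: "B * A = 1\<^sub>m (dim_row B)"
    using A by (auto simp: invertible_mat_def inverts_mat_def)
  have "dim_col (A * B) = n" using AB by simp
  moreover have "dim_col (B * A) = dim_row B" using BA by simp
  ultimately have "B \<in> carrier_mat n n" using A by auto
  hence "det A * det B = 1" using det_mult[OF A] AB by (metis det_one)
  thus "det A \<noteq> 0" by auto
next
  assume "det A \<noteq> 0"
  hence "A \<in> Units (ring_mat TYPE('a) n ())" by (rule det_non_zero_imp_unit[OF A])
  then obtain B where "B \<in> carrier_mat n n" "B * A = 1\<^sub>m n" "A * B = 1\<^sub>m n"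
    by (auto simp: Units_def ring_mat_def)
  thus "invertible_mat A"
    using A by (auto simp: invertible_mat_def inverts_mat_def square_mat.simps)
qed

lemma invertible_mat_iff_kernel:
  fixes A :: "'a :: field mat"
  assumes "A \<in> carrier_mat n n"
  shows "invertible_mat A \<longleftrightarrow> (\<forall>v \<in> carrier_vec n. A *\<^sub>v v = 0\<^sub>v n \<longrightarrow> v = 0\<^sub>v n)"
  using invertible_mat_iff_det[OF assms] det_0_iff_vec_prod_zero_field[OF assms] by blast

lemma minv_inverse:
  assumes A: "A \<in> carrier_mat n n" and inv: "invertible_mat A"
  shows "minv A \<in> carrier_mat n n" "A * minv A = 1\<^sub>m n" "minv A * A = 1\<^sub>m n"
proof -
  have "A \<in> Units (ring_mat TYPE(real) n ())"
    using inv invertible_mat_iff_det[OF A] det_non_zero_imp_unit[OF A, where b = "()"] by blast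
  then obtain B where "mat_inverse A = Some B"
    using mat_inverse(1)[OF A, where b = "()"] by (cases "mat_inverse A") auto
  thus "minv A \<in> carrier_mat n n" "A * minv A = 1\<^sub>m n" "minv A * A = 1\<^sub>m n"
    using mat_inverse(2)[OF A] by (auto simp: minv_def)
qed

text \<open>A right inverse of a square matrix is two-sided, so a single product settles both
  invertibility and the value of \<open>minv\<close>.\<close>

lemma minv_eqI:
  assumes A: "A \<in> carrier_mat n n" and B: "B \<in> carrier_mat n n" and AB: "A * B = 1\<^sub>m n"
  shows "invertible_mat A" "minv A = B"
proof -
  have BA: "B * A = 1\<^sub>m n" by (rule mat_mult_left_right_inverse[OF A B AB])
  show inv: "invertible_mat A"
    using A B AB BA by (auto simp: invertible_mat_def inverts_mat_def square_mat.simps)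
  note M = minv_inverse[OF A inv]
  have "minv A = (B * A) * minv A" using BA M(1) by simp
  also have "\<dots> = B * (A * minv A)" using A B M(1) by simp
  also have "\<dots> = B" using M(2) B by simp
  finally show "minv A = B" .
qed

lemma diagonal_mat_mat_diag: "diagonal_mat (mat_diag n f)"
  by (simp add: diagonal_mat_def mat_diag_def)

lemma mat_diag_mult_vec:
  assumes "v \<in> carrier_vec n"
  shows "mat_diag n f *\<^sub>v v = Matrix.vec n (\<lambda>i. f i * v $ i)"
proof (rule eq_vecI)
  fix i assume "i < dim_vec (Matrix.vec n (\<lambda>i. f i * v $ i))"
  hence i: "i < n" by simp
  have "(mat_diag n f *\<^sub>v v) $ i = (\<Sum>k\<in>{0..<n}. (if i = k then f k else 0) * v $ k)"
    using i assms by (simp add: mat_diag_def scalar_prod_def)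
  also have "\<dots> = f i * v $ i"
    using i by (subst sum.remove[of _ i]) auto
  finally have "(mat_diag n f *\<^sub>v v) $ i = f i * v $ i" .
  thus "(mat_diag n f *\<^sub>v v) $ i = Matrix.vec n (\<lambda>i. f i * v $ i) $ i" using i by simp
qed (simp add: mat_diag_def)

lemma mat_diag_mult_inverse:
  fixes f :: "nat \<Rightarrow> 'a :: field"
  assumes "\<forall>i<n. f i \<noteq> 0"
  shows "mat_diag n f * mat_diag n (\<lambda>i. inverse (f i)) = 1\<^sub>m n"
  using assms unfolding mat_diag_diag by (intro eq_matI) (auto simp: mat_diag_def)

lemma invertible_mat_diag:
  fixes f :: "nat \<Rightarrow> real"
  shows "invertible_mat (mat_diag n f) \<longleftrightarrow> (\<forall>i<n. f i \<noteq> 0)"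
proof
  assume inv: "invertible_mat (mat_diag n f)"
  show "\<forall>i<n. f i \<noteq> 0"
  proof (intro allI impI notI)
    fix i assume i: "i < n" and f: "f i = 0"
    have "mat_diag n f *\<^sub>v unit_vec n i = 0\<^sub>v n"
      using i f by (subst mat_diag_mult_vec) (auto simp: unit_vec_def)
    hence "unit_vec n i = (0\<^sub>v n :: real Matrix.vec)"
      using inv invertible_mat_iff_kernel[OF mat_diag_dim[of n f]] by simp
    hence "(unit_vec n i :: real Matrix.vec) $ i = 0\<^sub>v n $ i" by simp
    thus False using i by simp
  qed
next
  assume "\<forall>i<n. f i \<noteq> 0"
  thus "invertible_mat (mat_diag n f)"
    by (intro minv_eqI(1)[OF mat_diag_dim mat_diag_dim mat_diag_mult_inverse])
qed

lemma minv_mat_diag: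
  assumes "\<forall>i<n. f i \<noteq> 0"
  shows "minv (mat_diag n f) = mat_diag n (\<lambda>i. inverse (f i))"
  using assms by (intro minv_eqI(2)[OF mat_diag_dim mat_diag_dim mat_diag_mult_inverse])

section \<open>Positive definite matrices, their principal submatrices and their inverses\<close>

definition pos_def_mat :: "nat \<Rightarrow> real mat \<Rightarrow> bool" where
  "pos_def_mat n A \<longleftrightarrow> A \<in> carrier_mat n n \<and>
     (\<forall>v\<in>carrier_vec n. v \<noteq> 0\<^sub>v n \<longrightarrow> 0 < v \<bullet> (A *\<^sub>v v))"

lemma quadratic_form_eq_sum:
  fixes A :: "real mat"
  assumes "A \<in> carrier_mat n n" and "v \<in> carrier_vec n"
  shows "v \<bullet> (A *\<^sub>v v) = (\<Sum>i<n. \<Sum>j<n. v $ i * v $ j * A $$ (i, j))"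
  using assms
  by (auto simp: scalar_prod_def atLeast0LessThan sum_distrib_left mult_ac intro!: sum.cong)

lemma nonzero_vec_index:
  assumes "v \<in> carrier_vec n" and "v \<noteq> 0\<^sub>v n"
  obtains i where "i < n" and "v $ i \<noteq> 0"
proof -
  have "\<exists>i<n. v $ i \<noteq> 0"
  proof (rule ccontr)
    assume "\<not> (\<exists>i<n. v $ i \<noteq> 0)"
    hence "v = 0\<^sub>v n" using assms(1) by (intro eq_vecI) auto
    thus False using assms(2) by contradiction
  qed
  thus thesis using that by blast
qed

lemma scalar_prod_self_pos:
  fixes v :: "real Matrix.vec"
  assumes "v \<in> carrier_vec n" and "v \<noteq> 0\<^sub>v n"
  shows "0 < v \<bullet> v"
proof -
  obtain i where i: "i < n" "v $ i \<noteq> 0" by (rule nonzero_vec_index[OF assms])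
  have "0 < (\<Sum>k\<in>{0..<n}. v $ k * v $ k)"
    using i by (intro sum_pos2[of _ i]) (auto simp: zero_less_mult_iff linorder_neq_iff)
  thus ?thesis using assms by (simp add: scalar_prod_def)
qed

text \<open>A nonzero kernel vector, or an eigenvector for a nonpositive eigenvalue
  \<open>k\<close>, would make the form nonpositive, because
  \<open>v \<bullet> A v = k (v \<bullet> v)\<close>.\<close>

lemma M_matrix_if_pos_def:
  assumes pd: "pos_def_mat n A" and Z: "Z_matrix A"
  shows "M_matrix A"
proof -
  have A: "A \<in> carrier_mat n n" using pd by (simp add: pos_def_mat_def)
  have "invertible_mat A"
    unfolding invertible_mat_iff_kernel[OF A]
  proof (intro ballI impI)
    fix v assume v: "v \<in> carrier_vec n" and "A *\<^sub>v v = 0\<^sub>v n"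
    hence "v \<bullet> (A *\<^sub>v v) = 0" by simp
    thus "v = 0\<^sub>v n" using pd v by (force simp: pos_def_mat_def)
  qed
  moreover have "0 < k" if ev: "eigenvalue A k" for k
  proof -
    obtain v where v: "v \<in> carrier_vec n" "v \<noteq> 0\<^sub>v n" and Av: "A *\<^sub>v v = k \<cdot>\<^sub>v v"
      using ev A by (auto simp: eigenvalue_def eigenvector_def)
    have "0 < v \<bullet> (A *\<^sub>v v)" using pd v by (simp add: pos_def_mat_def)
    hence "0 < k * (v \<bullet> v)" using Av v by simp
    thus "0 < k" using scalar_prod_self_pos[OF v] by (simp add: zero_less_mult_iff)
  qed
  ultimately show ?thesis using Z by (simp add: M_matrix_def)
qed

lemma submatrix_carrier:
  assumes "A \<in> carrier_mat n n" and "S \<subseteq> {..<n}"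
  shows "principal_submatrix A S \<in> carrier_mat (card S) (card S)"
proof -
  have "{i. i < n \<and> i \<in> S} = S" using assms(2) by auto
  thus ?thesis using assms(1) by (intro carrier_matI) (simp_all add: dim_submatrix)
qed

lemma principal_submatrix_index:
  assumes "A \<in> carrier_mat n n" and "S \<subseteq> {..<n}" and "i < card S" and "j < card S"
  shows "principal_submatrix A S $$ (i, j) = A $$ (pick S i, pick S j)"
proof -
  have "{i. i < n \<and> i \<in> S} = S" using assms(2) by auto
  thus ?thesis using assms by (intro submatrix_index) simp_all
qed

text \<open>\<open>pick S\<close> enumerates \<open>S\<close> in increasing order from position 0;
  its inverse counts the elements below a given one. It serves to reindex sums over
  \<open>S\<close>.\<close>

lemma bij_betw_pick:
  assumes "finite S"
  shows "bij_betw (pick S) {..<card S} S"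
proof (rule bij_betw_byWitness[where f' = "\<lambda>i. card {a\<in>S. a < i}"])
  show "\<forall>k\<in>{..<card S}. card {a\<in>S. a < pick S k} = k"
    by (auto intro: card_pick_le)
  show "\<forall>i\<in>S. pick S (card {a\<in>S. a < i}) = i"
    by (simp add: pick_card_in_set)
  show "pick S ` {..<card S} \<subseteq> S"
    by (auto intro: pick_in_set_le)
  have "{a\<in>S. a < i} \<subset> S" if "i \<in> S" for i using that by auto
  thus "(\<lambda>i. card {a\<in>S. a < i}) ` S \<subseteq> {..<card S}"
    using assms by (auto intro: psubset_card_mono)
qed

lemma Z_matrix_principal_submatrix:
  assumes A: "A \<in> carrier_mat n n" and Z: "Z_matrix A" and S: "S \<subseteq> {..<n}"
  shows "Z_matrix (principal_submatrix A S)"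
proof -
  note C = submatrix_carrier[OF A S]
  have fin: "finite S" using S finite_subset by blast
  note bij = bij_betw_pick[OF fin]
  have "principal_submatrix A S $$ (i, j) \<le> 0" if ij: "i < card S" "j < card S" "i \<noteq> j" for i j
  proof -
    have "pick S i \<noteq> pick S j"
      using bij ij by (auto simp: bij_betw_def inj_on_def)
    moreover have "pick S i < n" "pick S j < n"
      using bij_betwE[OF bij] ij S by auto
    ultimately show ?thesis
      using Z A ij by (simp add: principal_submatrix_index[OF A S] Z_matrix_def)
  qed
  thus ?thesis using C by (auto simp: Z_matrix_def square_mat.simps)
qed

text \<open>Extending \<open>w\<close> by zero outside \<open>S\<close> gives a vector
  \<open>v\<close> at which the form of \<open>A\<close> has the value of the form of the submatrix
  at \<open>w\<close>.\<close>

lemma pos_def_principal_submatrix: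
  assumes pd: "pos_def_mat n A" and S: "S \<subseteq> {..<n}"
  shows "pos_def_mat (card S) (principal_submatrix A S)"
proof -
  have A: "A \<in> carrier_mat n n" using pd by (simp add: pos_def_mat_def)
  note C = submatrix_carrier[OF A S]
  have fin: "finite S" using S finite_subset by blast
  note bij = bij_betw_pick[OF fin]
  have "0 < w \<bullet> (principal_submatrix A S *\<^sub>v w)"
    if w: "w \<in> carrier_vec (card S)" and w0: "w \<noteq> 0\<^sub>v (card S)" for w
  proof -
    define v where "v = Matrix.vec n (\<lambda>i. if i \<in> S then w $ card {a\<in>S. a < i} else 0)"
    have v: "v \<in> carrier_vec n" by (simp add: v_def)
    have vp: "v $ pick S k = w $ k" if "k < card S" for k
    proof -
      have "pick S k \<in> S" using that bij_betwE[OF bij] by auto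
      thus ?thesis using that S card_pick_le[OF that] by (auto simp: v_def)
    qed
    obtain k where k: "k < card S" "w $ k \<noteq> 0" by (rule nonzero_vec_index[OF w w0])
    have "pick S k < n" using bij_betwE[OF bij] k S by auto
    hence "v \<noteq> 0\<^sub>v n" using vp[OF k(1)] k(2) by auto
    hence "0 < v \<bullet> (A *\<^sub>v v)" using pd v by (simp add: pos_def_mat_def)
    also have "\<dots> = (\<Sum>i<n. \<Sum>j<n. v $ i * v $ j * A $$ (i, j))"
      by (rule quadratic_form_eq_sum[OF A v])
    also have "\<dots> = (\<Sum>i\<in>S. \<Sum>j<n. v $ i * v $ j * A $$ (i, j))"
      using S by (intro sum.mono_neutral_right) (auto simp: v_def)
    also have "\<dots> = (\<Sum>i\<in>S. \<Sum>j\<in>S. v $ i * v $ j * A $$ (i, j))"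
      using S by (intro sum.cong[OF refl sum.mono_neutral_right]) (auto simp: v_def)
    also have "\<dots> = (\<Sum>i<card S. \<Sum>j<card S.
        v $ pick S i * v $ pick S j * A $$ (pick S i, pick S j))"
      unfolding sum.reindex_bij_betw[OF bij, symmetric] by simp
    also have "\<dots> = (\<Sum>i<card S. \<Sum>j<card S. w $ i * w $ j * principal_submatrix A S $$ (i, j))"
      by (intro sum.cong refl) (simp add: vp principal_submatrix_index[OF A S])
    also have "\<dots> = w \<bullet> (principal_submatrix A S *\<^sub>v w)"
      by (rule quadratic_form_eq_sum[OF C w, symmetric])
    finally show ?thesis .
  qed
  thus ?thesis using C by (simp add: pos_def_mat_def)
qed

lemma M_matrix_principal_submatrix:
  assumes pd: "pos_def_mat n A" and Z: "Z_matrix A" and S: "S \<subseteq> {..<n}"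
  shows "M_matrix (principal_submatrix A S)"
proof -
  have "A \<in> carrier_mat n n" using pd by (simp add: pos_def_mat_def)
  thus ?thesis
    using M_matrix_if_pos_def[OF pos_def_principal_submatrix[OF pd S]]
      Z_matrix_principal_submatrix[OF _ Z S] by blast
qed

text \<open>
  For \<open>w = A v\<close> the form at \<open>v + t w\<close> is \<open>2 t (w \<bullet> w) + t\<^sup>2 (w \<bullet> A w)\<close> when \<open>v \<bullet> A v = 0\<close>,
  which is nonnegative for all small negative \<open>t\<close> only if \<open>w = 0\<close>.
\<close>

lemma pos_def_if_psd_invertible:
  assumes A: "A \<in> carrier_mat n n" and sym: "transpose_mat A = A"
    and psd: "\<And>v. v \<in> carrier_vec n \<Longrightarrow> 0 \<le> v \<bullet> (A *\<^sub>v v)"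
    and inv: "invertible_mat A"
  shows "pos_def_mat n A"
  unfolding pos_def_mat_def
proof (intro conjI ballI impI A)
  fix v :: "real Matrix.vec" assume v: "v \<in> carrier_vec n" and v0: "v \<noteq> 0\<^sub>v n"
  show "0 < v \<bullet> (A *\<^sub>v v)"
  proof (rule ccontr)
    assume "\<not> 0 < v \<bullet> (A *\<^sub>v v)"
    hence vv: "v \<bullet> (A *\<^sub>v v) = 0" using psd[OF v] by simp
    define w where "w = A *\<^sub>v v"
    have w: "w \<in> carrier_vec n" using A v by (simp add: w_def)
    have Aw: "A *\<^sub>v w \<in> carrier_vec n" using A w by simp
    have vw: "v \<bullet> (A *\<^sub>v w) = w \<bullet> w"
      using transpose_vec_mult_scalar[OF A w v] sym by (simp add: w_def)
    define P where "P = w \<bullet> (A *\<^sub>v w)"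
    have "w \<noteq> 0\<^sub>v n"
      using inv v v0 unfolding invertible_mat_iff_kernel[OF A] w_def by blast
    hence ww: "0 < w \<bullet> w" by (rule scalar_prod_self_pos[OF w])
    have form: "0 \<le> 2 * t * (w \<bullet> w) + t\<^sup>2 * P" for t
    proof -
      have tw: "t \<cdot>\<^sub>v w \<in> carrier_vec n" using w by simp
      have "A *\<^sub>v (v + t \<cdot>\<^sub>v w) = w + t \<cdot>\<^sub>v (A *\<^sub>v w)"
        using A v w by (simp add: mult_add_distrib_mat_vec[OF A] mult_mat_vec w_def)
      hence "(v + t \<cdot>\<^sub>v w) \<bullet> (A *\<^sub>v (v + t \<cdot>\<^sub>v w))
          = v \<bullet> w + t * (v \<bullet> (A *\<^sub>v w)) + (t * (w \<bullet> w) + t * (t * P))"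
        using v w tw Aw
        by (simp add: add_scalar_prod_distrib[of _ n] scalar_prod_add_distrib[of _ n] P_def)
      also have "\<dots> = 2 * t * (w \<bullet> w) + t\<^sup>2 * P"
        using vv vw by (simp add: w_def power2_eq_square)
      finally show ?thesis using psd[of "v + t \<cdot>\<^sub>v w"] v tw by simp
    qed
    have P0: "0 \<le> P" using psd[OF w] by (simp add: P_def)
    \<comment> \<open>The minimizing \<open>t\<close> would have \<open>P\<close> as its
      denominator, which may be zero. With \<open>P + 1\<close> instead, \<open>P / r\<close> stays
      below one and the second factor below stays negative.\<close>
    define r where "r = P + 1"
    define t where "t = - (w \<bullet> w) / r"
    have "2 * t * (w \<bullet> w) + t\<^sup>2 * P = (w \<bullet> w)\<^sup>2 / r * (P / r - 2)"
      by (simp add: t_def power2_eq_square algebra_simps diff_divide_distrib)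
    moreover have "P / r - 2 < 0" using P0 by (simp add: r_def field_simps)
    moreover have "(w \<bullet> w)\<^sup>2 / r > 0" using P0 ww by (simp add: r_def)
    ultimately have "2 * t * (w \<bullet> w) + t\<^sup>2 * P < 0" by (simp only: mult_pos_neg)
    thus False using form[of t] by simp
  qed
qed

text \<open>Substituting \<open>v = A y\<close> turns the form of the inverse at \<open>v\<close>
  into the form of \<open>A\<close> at \<open>y\<close>.\<close>

lemma pos_def_minv:
  assumes pd: "pos_def_mat n A" and inv: "invertible_mat A"
  shows "pos_def_mat n (minv A)"
proof -
  have A: "A \<in> carrier_mat n n" using pd by (simp add: pos_def_mat_def)
  note M = minv_inverse[OF A inv]
  have "0 < v \<bullet> (minv A *\<^sub>v v)" if v: "v \<in> carrier_vec n" "v \<noteq> 0\<^sub>v n" for v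
  proof -
    define y where "y = minv A *\<^sub>v v"
    have y: "y \<in> carrier_vec n" using M(1) v(1) by (simp add: y_def)
    have Ay: "A *\<^sub>v y = v"
      using assoc_mult_mat_vec[OF A M(1) v(1)] M(2) v(1) by (simp add: y_def)
    have "A *\<^sub>v 0\<^sub>v n = 0\<^sub>v n" using A by (intro eq_vecI) auto
    hence "y \<noteq> 0\<^sub>v n" using Ay v(2) by metis
    hence "0 < y \<bullet> (A *\<^sub>v y)" using pd y by (simp add: pos_def_mat_def)
    also have "y \<bullet> (A *\<^sub>v y) = v \<bullet> y" using Ay comm_scalar_prod[OF y v(1)] by simp
    finally show ?thesis by (simp add: y_def)
  qed
  thus ?thesis using M(1) by (simp add: pos_def_mat_def)
qed

lemma pos_def_diag_pos:
  assumes pd: "pos_def_mat n A" and i: "i < n"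
  shows "0 < A $$ (i, i)"
proof -
  have A: "A \<in> carrier_mat n n" using pd by (simp add: pos_def_mat_def)
  have "(unit_vec n i :: real Matrix.vec) $ i \<noteq> 0\<^sub>v n $ i" using i by simp
  hence "(unit_vec n i :: real Matrix.vec) \<noteq> 0\<^sub>v n" by auto
  hence "0 < unit_vec n i \<bullet> (A *\<^sub>v unit_vec n i)"
    using pd by (simp add: pos_def_mat_def)
  thus ?thesis using A i by simp
qed

section \<open>Diagonal matrices with a rank one update\<close>

lemma outer_carrier [simp]: "v \<in> carrier_vec n \<Longrightarrow> w \<in> carrier_vec m \<Longrightarrow> outer v w \<in> carrier_mat n m"
  by (simp add: outer_def)

lemma dim_outer [simp]: "dim_row (outer v w) = dim_vec v" "dim_col (outer v w) = dim_vec w"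
  by (simp_all add: outer_def)

lemma outer_index [simp]: "i < dim_vec v \<Longrightarrow> j < dim_vec w \<Longrightarrow> outer v w $$ (i, j) = v $ i * w $ j"
  by (simp add: outer_def)

lemma outer_mult_vec:
  assumes "v \<in> carrier_vec n" and "w \<in> carrier_vec m" and "y \<in> carrier_vec m"
  shows "outer v w *\<^sub>v y = (w \<bullet> y) \<cdot>\<^sub>v v"
  using assms by (intro eq_vecI) (auto simp: outer_def scalar_prod_def sum_distrib_left mult_ac)

lemma mult_mat_index_col:
  assumes "A \<in> carrier_mat nr n" and "B \<in> carrier_mat n nc" and "i < nr" and "j < nc"
  shows "(A * B) $$ (i, j) = (A *\<^sub>v col B j) $ i"
  using assms by simp

context
  fixes s :: nat and q :: "nat \<Rightarrow> real" and x :: "real Matrix.vec" and \<gamma> :: real and A :: "real mat"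
  assumes x: "x \<in> carrier_vec s"
  defines "A \<equiv> mat_diag s q + \<gamma> \<cdot>\<^sub>m outer x x"
begin

lemma update_carrier: "A \<in> carrier_mat s s"
  using x by (simp add: A_def)

lemma update_index:
  "i < s \<Longrightarrow> j < s \<Longrightarrow> A $$ (i, j) = (if i = j then q i else 0) + \<gamma> * (x $ i * x $ j)"
  using x by (simp add: A_def mat_diag_def outer_def)

lemma transpose_update: "transpose_mat A = A"
  using update_carrier by (intro eq_matI) (auto simp: update_index)

lemma update_mult_vec:
  assumes y: "y \<in> carrier_vec s" and i: "i < s"
  shows "(A *\<^sub>v y) $ i = q i * y $ i + \<gamma> * x $ i * (x \<bullet> y)"
proof -
  have "A *\<^sub>v y = mat_diag s q *\<^sub>v y + \<gamma> \<cdot>\<^sub>m outer x x *\<^sub>v y"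
    unfolding A_def using x y by (intro add_mult_distrib_mat_vec[of _ s s]) auto
  also have "\<gamma> \<cdot>\<^sub>m outer x x *\<^sub>v y = \<gamma> \<cdot>\<^sub>v (outer x x *\<^sub>v y)"
    using x y by (intro eq_vecI) auto
  finally show ?thesis
    using x y i by (simp add: mat_diag_mult_vec outer_mult_vec)
qed

text \<open>Everything rests on \<open>A a = d x\<close>, a consequence of
  \<open>q_i a_i = x_i\<close>. If \<open>d\<close> is zero, then \<open>a\<close> lies in the
  kernel, and it is nonzero since \<open>a = 0\<close> would give \<open>d = 1\<close>. Otherwise
  the correction term cancels the rank one part in each column.\<close>

lemma sherman_morrison:
  assumes q: "\<forall>i<s. q i \<noteq> 0"
  defines "a \<equiv> Matrix.vec s (\<lambda>i. inverse (q i) * x $ i)"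
  defines "d \<equiv> 1 + \<gamma> * (a \<bullet> x)"
  shows "invertible_mat A \<longleftrightarrow> d \<noteq> 0"
    and "d \<noteq> 0 \<Longrightarrow> minv A = mat_diag s (\<lambda>i. inverse (q i)) - (\<gamma> / d) \<cdot>\<^sub>m outer a a"
proof -
  have a: "a \<in> carrier_vec s" by (simp add: a_def)
  have xa: "x \<bullet> a = a \<bullet> x" using comm_scalar_prod[OF x a] .
  have qa: "q i * a $ i = x $ i" if "i < s" for i using q that by (simp add: a_def)
  have Aa: "A *\<^sub>v a = d \<cdot>\<^sub>v x"
  proof (rule eq_vecI)
    fix i assume "i < dim_vec (d \<cdot>\<^sub>v x)"
    hence i: "i < s" using x by simp
    show "(A *\<^sub>v a) $ i = (d \<cdot>\<^sub>v x) $ i"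
      using i x by (simp add: update_mult_vec[OF a] qa xa d_def algebra_simps del: index_mult_mat_vec)
  qed (use x update_carrier in simp)
  let ?B = "mat_diag s (\<lambda>i. inverse (q i)) - (\<gamma> / d) \<cdot>\<^sub>m outer a a"
  have B: "?B \<in> carrier_mat s s" using a by (intro minus_carrier_mat) simp
  have AB: "A * ?B = 1\<^sub>m s" if d: "d \<noteq> 0"
  proof (rule eq_matI)
    fix i j assume "i < dim_row (1\<^sub>m s)" "j < dim_col (1\<^sub>m s)"
    hence i: "i < s" and j: "j < s" by auto
    have colB: "col ?B j = inverse (q j) \<cdot>\<^sub>v unit_vec s j - (\<gamma> / d * a $ j) \<cdot>\<^sub>v a"
      using a j by (intro eq_vecI) (auto simp: mat_diag_def)
    have "(A * ?B) $$ (i, j) = (A *\<^sub>v col ?B j) $ i"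
      using i j by (rule mult_mat_index_col[OF update_carrier B])
    also have "A *\<^sub>v col ?B j = inverse (q j) \<cdot>\<^sub>v (A *\<^sub>v unit_vec s j) - (\<gamma> / d * a $ j) \<cdot>\<^sub>v (A *\<^sub>v a)"
      unfolding colB using a update_carrier
      by (simp add: mult_minus_distrib_mat_vec[OF update_carrier] mult_mat_vec)
    also have "\<dots> $ i = inverse (q j) * (q i * unit_vec s j $ i + \<gamma> * x $ i * x $ j)
        - \<gamma> / d * a $ j * (d * x $ i)"
      using i j x a update_carrier by (simp add: Aa update_mult_vec del: index_unit_vec index_mult_mat_vec)
    also have "\<dots> = 1\<^sub>m s $$ (i, j)"
      using i j d q by (simp add: a_def unit_vec_def field_simps)
    finally show "(A * ?B) $$ (i, j) = 1\<^sub>m s $$ (i, j)" .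
  qed (use B update_carrier in auto)
  show "invertible_mat A \<longleftrightarrow> d \<noteq> 0"
  proof
    assume inv: "invertible_mat A"
    show "d \<noteq> 0"
    proof
      assume d: "d = 0"
      moreover have "0 \<cdot>\<^sub>v x = 0\<^sub>v s" using x by (intro eq_vecI) auto
      ultimately have "A *\<^sub>v a = 0\<^sub>v s" using Aa by simp
      hence "a = 0\<^sub>v s" using inv a unfolding invertible_mat_iff_kernel[OF update_carrier] by blast
      thus False using d x by (simp add: d_def)
    qed
  qed (use minv_eqI(1)[OF update_carrier B AB] in blast)
  show "minv A = ?B" if "d \<noteq> 0"
    using minv_eqI(2)[OF update_carrier B AB[OF that]] .
qed

text \<open>Since \<open>Q a = x\<close> for the diagonal matrix \<open>Q\<close>, the number
  \<open>a'Qa\<close> in the denominator is \<open>a \<bullet> x\<close>, and the previous lemma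
  applies.\<close>

lemma sherman_morrison_minv:
  assumes inv: "invertible_mat (mat_diag s q)"
  defines "a \<equiv> minv (mat_diag s q) *\<^sub>v x"
  defines "d \<equiv> 1 + \<gamma> * (a \<bullet> (mat_diag s q *\<^sub>v a))"
  shows "invertible_mat A \<longleftrightarrow> d \<noteq> 0"
    and "d \<noteq> 0 \<Longrightarrow> minv A = minv (mat_diag s q) - (\<gamma> / d) \<cdot>\<^sub>m outer a a"
proof -
  have q: "\<forall>i<s. q i \<noteq> 0" using inv by (simp only: invertible_mat_diag)
  note M = minv_mat_diag[OF q]
  have a: "a = Matrix.vec s (\<lambda>i. inverse (q i) * x $ i)"
    unfolding a_def M by (rule mat_diag_mult_vec[OF x])
  have "mat_diag s q *\<^sub>v a = x"
    using q x by (intro eq_vecI) (simp_all add: a mat_diag_mult_vec del: index_mult_mat_vec)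
  hence d: "d = 1 + \<gamma> * (a \<bullet> x)" by (simp add: d_def)
  show "invertible_mat A \<longleftrightarrow> d \<noteq> 0"
    unfolding d a by (rule sherman_morrison(1)[OF q])
  show "d \<noteq> 0 \<Longrightarrow> minv A = minv (mat_diag s q) - (\<gamma> / d) \<cdot>\<^sub>m outer a a"
    unfolding d a M by (rule sherman_morrison(2)[OF q])
qed

text \<open>
  Column \<open>j\<close> of the inverse is the solution \<open>y\<close> of \<open>q\<^sub>i y\<^sub>i + \<gamma> x\<^sub>i (x \<bullet> y) = \<delta>\<^sub>i\<^sub>j\<close>. Since
  \<open>y\<^sub>j > 0\<close>, the scalar \<open>x \<bullet> y\<close> cannot be negative, and a nonnegative \<open>x \<bullet> y\<close> forces the other
  entries to be nonpositive. An index with \<open>q\<^sub>i = 0\<close> is unique by invertibility and needs extra care.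
\<close>

lemma Z_matrix_minv_update:
  assumes \<gamma>: "0 \<le> \<gamma>" and x0: "\<And>i. i < s \<Longrightarrow> 0 \<le> x $ i"
    and pd: "pos_def_mat s A" and inv: "invertible_mat A"
    and q: "s \<le> 2 \<or> (\<forall>i<s. 0 \<le> q i)"
  shows "Z_matrix (minv A)"
proof -
  note M = minv_inverse[OF update_carrier inv]
  have "minv A $$ (i, j) \<le> 0" if i: "i < s" and j: "j < s" and ij: "i \<noteq> j" for i j
  proof -
    define y where "y = col (minv A) j"
    have y: "y \<in> carrier_vec s" using M(1) j by (auto simp: y_def)
    have yi: "y $ k = minv A $$ (k, j)" if "k < s" for k
      using M(1) j that by (simp add: y_def)
    define t where "t = x \<bullet> y"
    have tsum: "t = (\<Sum>k<s. x $ k * y $ k)"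
      using y by (simp add: t_def scalar_prod_def atLeast0LessThan)
    have eq: "q k * y $ k + \<gamma> * x $ k * t = (if k = j then 1 else 0)" if k: "k < s" for k
    proof -
      have "(A *\<^sub>v y) $ k = (A * minv A) $$ (k, j)"
        unfolding y_def by (rule mult_mat_index_col[OF update_carrier M(1) k j, symmetric])
      thus ?thesis using update_mult_vec[OF y k] M(2) j k by (simp add: t_def)
    qed
    have yj: "0 < y $ j"
      using pos_def_diag_pos[OF pos_def_minv[OF pd inv] j] yi[OF j] by simp
    have "y $ i \<le> 0"
    proof (cases "\<forall>k<s. 0 \<le> q k")
      \<comment> \<open>Some \<open>q k\<close> is negative, so \<open>i\<close> and
        \<open>j\<close> are the only indices. Row \<open>i\<close> of the system then says that
        \<open>A_ii y_i = - A_ij y_j\<close>, where \<open>A_ii\<close> is positive as a diagonal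
        entry.\<close>
      case False
      hence "s \<le> 2" using q by blast
      hence s: "{..<s} = {i, j}" using i j ij by auto
      hence t: "t = x $ i * y $ i + x $ j * y $ j" using tsum ij by simp
      have "0 < q i + \<gamma> * (x $ i * x $ i)"
        using pos_def_diag_pos[OF pd i] i by (simp add: update_index)
      moreover have "(q i + \<gamma> * (x $ i * x $ i)) * y $ i = - (\<gamma> * x $ i * x $ j * y $ j)"
        using eq[OF i] ij by (simp add: t algebra_simps)
      moreover have "0 \<le> \<gamma> * x $ i * x $ j * y $ j"
        using \<gamma> x0[OF i] x0[OF j] yj by simp
      ultimately show ?thesis by (smt (verit) mult_pos_pos)
    next
      case True
      have sg: "0 \<le> \<gamma> * x $ k" if "k < s" for k using \<gamma> x0[OF that] by simp
      have qy: "q k * y $ k = - (\<gamma> * x $ k * t)" if "k < s" "k \<noteq> j" for k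
        using eq[OF that(1)] that(2) by simp
      \<comment> \<open>At such an index the diagonal entry of \<open>A\<close> is just
        \<open>\<gamma> x_k^2\<close>, and it must be positive.\<close>
      have zero: "0 < \<gamma> * x $ k \<and> 0 < x $ k" if k: "k < s" "q k = 0" for k
        using pos_def_diag_pos[OF pd k(1)] k sg[OF k(1)] x0[OF k(1)] \<gamma>
        by (auto simp: update_index zero_less_mult_iff)
      \<comment> \<open>If \<open>t\<close> were negative, each row \<open>k\<close> other than
        \<open>j\<close> would give \<open>y_k\<close> a nonnegative value; \<open>q k = 0\<close>
        is impossible there, as the row would read \<open>\<gamma> x_k t = 0\<close>. Then all terms
        of the sum \<open>t\<close> would be nonnegative.\<close>
      have t0: "0 \<le> t"
      proof (rule ccontr)
        assume "\<not> 0 \<le> t"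
        hence t: "t < 0" by simp
        have "0 \<le> x $ k * y $ k" if k: "k < s" for k
        proof (cases "k = j")
          case True
          thus ?thesis using x0[OF k] yj by simp
        next
          case False
          have "q k \<noteq> 0"
            using qy[OF k False] zero[OF k] t by auto
          moreover have "0 \<le> q k * y $ k"
            unfolding qy[OF k False] using sg[OF k] t by (simp add: mult_nonneg_nonpos)
          ultimately have "0 \<le> y $ k" using True k by (auto simp: zero_le_mult_iff)
          thus ?thesis using x0[OF k] by simp
        qed
        hence "0 \<le> t" unfolding tsum by (intro sum_nonneg) auto
        thus False using t by simp
      qed
      show ?thesis
      proof (cases "q i = 0")
        case False
        hence "0 < q i" using True i by (simp add: order_less_le)
        moreover have "q i * y $ i \<le> 0"
          unfolding qy[OF i ij] using sg[OF i] t0 by simp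
        ultimately show ?thesis by (simp add: mult_le_0_iff)
      next
        case qi: True
        have t: "t = 0" using qy[OF i ij] zero[OF i qi] qi by auto
        have yk: "y $ k = 0" if k: "k < s" "k \<noteq> i" "k \<noteq> j" for k
        proof -
          have "q k \<noteq> 0"
          proof
            assume qk: "q k = 0"
            \<comment> \<open>A second zero of \<open>q\<close> yields a kernel vector: this
              combination is orthogonal to \<open>x\<close> and supported on the two indices where
              the diagonal part vanishes.\<close>
            define v where "v = x $ k \<cdot>\<^sub>v unit_vec s i - x $ i \<cdot>\<^sub>v unit_vec s k"
            have v: "v \<in> carrier_vec s" by (simp add: v_def)
            have "x \<bullet> v = 0"
              using x i k by (simp add: v_def scalar_prod_minus_distrib[of _ s])
            moreover have "q l * v $ l = 0" if "l < s" for l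
              using that qi qk by (auto simp: v_def unit_vec_def)
            ultimately have "A *\<^sub>v v = 0\<^sub>v s"
              using update_carrier by (intro eq_vecI) (auto simp: update_mult_vec[OF v] simp del: index_mult_mat_vec)
            hence "v = 0\<^sub>v s"
              using inv v unfolding invertible_mat_iff_kernel[OF update_carrier] by blast
            hence "v $ i = 0" using i by simp
            thus False using zero[OF k(1) qk] i k by (simp add: v_def unit_vec_def)
          qed
          thus ?thesis using qy[OF k(1,3)] t by simp
        qed
        \<comment> \<open>With all other \<open>y_k\<close> zero, the relation \<open>t = 0\<close>
          itself determines the sign of \<open>y_i\<close>, which row \<open>i\<close> leaves open
          when \<open>q i = 0\<close>.\<close>
        have "t = (\<Sum>k\<in>{i, j}. x $ k * y $ k)"
          unfolding tsum using i j yk by (intro sum.mono_neutral_right) auto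
        hence "x $ i * y $ i = - (x $ j * y $ j)" using t ij by simp
        also have "\<dots> \<le> 0" using x0[OF j] yj by simp
        finally show ?thesis using zero[OF i qi] by (auto simp: mult_le_0_iff)
      qed
    qed
    thus ?thesis using yi[OF i] by simp
  qed
  thus ?thesis using M(1) by (auto simp: Z_matrix_def square_mat.simps)
qed

context
  assumes x0: "\<And>i. i < s \<Longrightarrow> 0 \<le> x $ i"
    and psd: "\<And>v. v \<in> carrier_vec s \<Longrightarrow> 0 \<le> v \<bullet> (A *\<^sub>v v)"
    and inv: "invertible_mat A"
begin

text \<open>Here the off-diagonal entries are visible: they are
  \<open>\<gamma> x_i x_j\<close>.\<close>

lemma M_matrix_update:
  assumes \<gamma>: "\<gamma> \<le> 0" and S: "S \<subseteq> {..<s}"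
  shows "M_matrix (principal_submatrix A S)"
proof -
  have "A $$ (i, j) \<le> 0" if "i < s" "j < s" "i \<noteq> j" for i j
    using that \<gamma> x0[of i] x0[of j] by (simp add: update_index mult_nonpos_nonneg)
  hence "Z_matrix A" using update_carrier by (auto simp: Z_matrix_def square_mat.simps)
  thus ?thesis
    using pos_def_if_psd_invertible[OF update_carrier transpose_update psd inv] S
    by (intro M_matrix_principal_submatrix)
qed

lemma M_matrix_minv_update:
  assumes \<gamma>: "0 \<le> \<gamma>" and q: "s \<le> 2 \<or> (\<forall>i<s. 0 \<le> q i)" and S: "S \<subseteq> {..<s}"
  shows "M_matrix (principal_submatrix (minv A) S)"
proof -
  have pd: "pos_def_mat s A"
    by (rule pos_def_if_psd_invertible[OF update_carrier transpose_update psd inv])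
  show ?thesis
    by (intro M_matrix_principal_submatrix[OF _ _ S] pos_def_minv[OF pd inv]
        Z_matrix_minv_update[OF \<gamma> x0 pd inv q])
qed

end

end

section \<open>Congruence by a diagonal matrix, leading from covariances to correlations\<close>

lemma diag_congruence_index:
  assumes "A \<in> carrier_mat n n" and "i < n" and "j < n"
  shows "(mat_diag n r * A * mat_diag n r) $$ (i, j) = r i * A $$ (i, j) * r j"
  using assms by (simp add: mat_diag_mult_left mat_diag_mult_right[of _ n n])

lemma diag_congruence_diag:
  fixes r q :: "nat \<Rightarrow> real"
  shows "mat_diag n r * mat_diag n q * mat_diag n r = mat_diag n (\<lambda>i. r i * q i * r i)"
  by simp

text \<open>Rescaling rows and columns alike preserves the shape of a diagonal matrix plus a rank
  one term, so the correlation matrix falls under the same lemmas as the covariance matrix.\<close>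

lemma diag_congruence_update:
  assumes x: "x \<in> carrier_vec n"
  shows "mat_diag n r * (mat_diag n q + \<gamma> \<cdot>\<^sub>m outer x x) * mat_diag n r =
    mat_diag n r * mat_diag n q * mat_diag n r
      + \<gamma> \<cdot>\<^sub>m outer (mat_diag n r *\<^sub>v x) (mat_diag n r *\<^sub>v x)"
proof -
  have A: "mat_diag n q + \<gamma> \<cdot>\<^sub>m outer x x \<in> carrier_mat n n" using x by simp
  have u: "mat_diag n r *\<^sub>v x = Matrix.vec n (\<lambda>i. r i * x $ i)" by (rule mat_diag_mult_vec[OF x])
  show ?thesis
    unfolding u
  proof (rule eq_matI)
    fix i j
    assume "i < dim_row (mat_diag n r * mat_diag n q * mat_diag n r
        + \<gamma> \<cdot>\<^sub>m outer (Matrix.vec n (\<lambda>i. r i * x $ i)) (Matrix.vec n (\<lambda>i. r i * x $ i)))"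
      and "j < dim_col (mat_diag n r * mat_diag n q * mat_diag n r
        + \<gamma> \<cdot>\<^sub>m outer (Matrix.vec n (\<lambda>i. r i * x $ i)) (Matrix.vec n (\<lambda>i. r i * x $ i)))"
    hence ij: "i < n" "j < n" by auto
    show "(mat_diag n r * (mat_diag n q + \<gamma> \<cdot>\<^sub>m outer x x) * mat_diag n r) $$ (i, j) =
        (mat_diag n r * mat_diag n q * mat_diag n r
        + \<gamma> \<cdot>\<^sub>m outer (Matrix.vec n (\<lambda>i. r i * x $ i)) (Matrix.vec n (\<lambda>i. r i * x $ i))) $$ (i, j)"
      unfolding diag_congruence_index[OF A ij] diag_congruence_diag
      using ij x by (simp add: mat_diag_def algebra_simps)
  qed (simp_all add: mat_diag_def)
qed

text \<open>The form of the rescaled matrix at \<open>v\<close> is the form of \<open>A\<close> at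
  the vector with entries \<open>r i * v $ i\<close>.\<close>

lemma diag_congruence_psd:
  fixes A :: "real mat"
  assumes A: "A \<in> carrier_mat n n"
    and psd: "\<And>v. v \<in> carrier_vec n \<Longrightarrow> 0 \<le> v \<bullet> (A *\<^sub>v v)" and v: "v \<in> carrier_vec n"
  shows "0 \<le> v \<bullet> (mat_diag n r * A * mat_diag n r *\<^sub>v v)"
proof -
  define w where "w = Matrix.vec n (\<lambda>i. r i * v $ i)"
  have w: "w \<in> carrier_vec n" by (simp add: w_def)
  have C: "mat_diag n r * A * mat_diag n r \<in> carrier_mat n n"
    using A by (intro mult_carrier_mat[of _ n n]) auto
  have "0 \<le> (\<Sum>i<n. \<Sum>j<n. w $ i * w $ j * A $$ (i, j))"
    using psd[OF w] quadratic_form_eq_sum[OF A w] by simp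
  also have "\<dots> = (\<Sum>i<n. \<Sum>j<n. v $ i * v $ j * (mat_diag n r * A * mat_diag n r) $$ (i, j))"
    using A by (intro sum.cong refl) (simp add: w_def diag_congruence_index del: index_mult_mat)
  finally show ?thesis by (simp only: quadratic_form_eq_sum[OF C v])
qed

theorem theorem4:
  fixes n s :: nat and c f :: "nat \<Rightarrow> nat" and E :: "nat set set"
    and m \<gamma> :: real and x u :: "real Matrix.vec" and \<Sigma> Q \<Gamma> Qt :: "real mat"
  assumes "n \<ge> 4"
    and "simple_graph n E"
    and "is_profile n s c"
    and "f \<in> colorings n s c"
    and "m = real (card E)"
    and "\<gamma> = gamma_graph n E"
    and "\<Sigma> = cov_mat n s c E"
    and "Q = mat_diag s (q_entry n s c E)"
    and "x = ff2_vec s c"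
    and "\<Gamma> = D_inv_sqrt n s c E * \<Sigma> * D_inv_sqrt n s c E"
    and "Qt = D_inv_sqrt n s c E * Q * D_inv_sqrt n s c E"
    and "u = D_inv_sqrt n s c E *\<^sub>v x"
  shows
    "(\<forall>i<s. sigma_sq n s c E i =
        m * (ffact (c i) 2 / ffact n 2) * (1 - m * (ffact (c i) 2 / ffact n 2))
        + 2 * ((ffact (c i) 3 / ffact n 3 - ffact (c i) 4 / ffact n 4) * real (pi3 E)
               + ffact (c i) 4 / ffact n 4 * real (card E choose 2)))
     \<and> \<Sigma> = Q + \<gamma> \<cdot>\<^sub>m outer x x
     \<and> (invertible_mat Q \<longrightarrow>
          (let a = minv Q *\<^sub>v x; d = 1 + \<gamma> * scalar_prod a (Q *\<^sub>v a)
           in (invertible_mat \<Sigma> \<longleftrightarrow> d \<noteq> 0) \<and>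
              (d \<noteq> 0 \<longrightarrow> minv \<Sigma> =
                 mat_diag s (\<lambda>i. inverse (q_entry n s c E i)) - (\<gamma> / d) \<cdot>\<^sub>m outer a a)))
     \<and> (\<gamma> \<le> 0 \<and> invertible_mat \<Sigma> \<longrightarrow>
          (\<forall>S. S \<noteq> {} \<and> S \<subseteq> {..<s} \<longrightarrow> M_matrix (principal_submatrix \<Sigma> S)))
     \<and> (\<gamma> \<ge> 0 \<and> invertible_mat \<Sigma> \<and> (s \<le> 2 \<or> (\<forall>i<s. 0 \<le> Q $$ (i, i))) \<longrightarrow>
          (\<forall>S. S \<noteq> {} \<and> S \<subseteq> {..<s} \<longrightarrow> M_matrix (principal_submatrix (minv \<Sigma>) S)))
     \<and> ((\<forall>i<s. 0 < sigma_sq n s c E i) \<longrightarrow>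
          diagonal_mat Qt
        \<and> \<Gamma> = Qt + \<gamma> \<cdot>\<^sub>m outer u u
        \<and> (invertible_mat Qt \<longrightarrow>
             (let b = minv Qt *\<^sub>v u; d = 1 + \<gamma> * scalar_prod b (Qt *\<^sub>v b)
              in (invertible_mat \<Gamma> \<longleftrightarrow> d \<noteq> 0) \<and>
                 (d \<noteq> 0 \<longrightarrow> minv \<Gamma> = minv Qt - (\<gamma> / d) \<cdot>\<^sub>m outer b b)))
        \<and> (\<gamma> \<le> 0 \<and> invertible_mat \<Gamma> \<longrightarrow>
             (\<forall>S. S \<noteq> {} \<and> S \<subseteq> {..<s} \<longrightarrow> M_matrix (principal_submatrix \<Gamma> S)))
        \<and> (\<gamma> \<ge> 0 \<and> invertible_mat \<Gamma> \<and> (s \<le> 2 \<or> (\<forall>i<s. 0 \<le> Qt $$ (i, i))) \<longrightarrow>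
             (\<forall>S. S \<noteq> {} \<and> S \<subseteq> {..<s} \<longrightarrow> M_matrix (principal_submatrix (minv \<Gamma>) S))))"
proof -
  define q where "q = q_entry n s c E"
  define r where "r i = 1 / sqrt (sigma_sq n s c E i)" for i
  have C: "colorings n s c \<noteq> {}" using assms(4) by blast
  have x: "x \<in> carrier_vec s" by (simp add: assms(9) ff2_vec_def)
  have xi: "x $ i = ffact (c i) 2" if "i < s" for i using that by (simp add: assms(9) ff2_vec_def)
  have x0: "0 \<le> x $ i" if "i < s" for i using that by (simp add: xi ffact_2_nonneg)
  have Q: "Q = mat_diag s q" by (simp add: assms(8) q_def)
  have cov: "\<Sigma> \<in> carrier_mat s s"
    and cov_index: "i < s \<Longrightarrow> j < s \<Longrightarrow>
      \<Sigma> $$ (i, j) = covariance (random_coloring n s c) (mono_edges E i) (mono_edges E j)" for i j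
    by (simp_all add: assms(7) cov_mat_def)
  have var: "sigma_sq n s c E i = covariance (random_coloring n s c) (mono_edges E i) (mono_edges E i)" for i
    unfolding sigma_sq_def by (rule variance_eq_covariance)
  \<comment> \<open>On the diagonal this is the choice of \<open>q_entry\<close>, made to compensate
    the rank one term; the content lies in the entries off the diagonal.\<close>
  have \<Sigma>: "\<Sigma> = mat_diag s q + \<gamma> \<cdot>\<^sub>m outer x x"
  proof (rule eq_matI)
    fix i j assume "i < dim_row (mat_diag s q + \<gamma> \<cdot>\<^sub>m outer x x)"
      and "j < dim_col (mat_diag s q + \<gamma> \<cdot>\<^sub>m outer x x)"
    hence ij: "i < s" "j < s" using x by auto
    show "\<Sigma> $$ (i, j) = (mat_diag s q + \<gamma> \<cdot>\<^sub>m outer x x) $$ (i, j)"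
      unfolding cov_index[OF ij] update_index[OF x ij]
      using covariance_mono_edges_distinct[OF assms(2) C ij]
      by (cases "i = j") (simp_all add: q_def q_entry_def var xi ij assms(6) power2_eq_square)
  qed (use cov x in auto)
  have psd: "0 \<le> v \<bullet> (\<Sigma> *\<^sub>v v)" if v: "v \<in> carrier_vec s" for v
    unfolding quadratic_form_eq_sum[OF cov v]
    using covariance_mono_edges_psd[OF assms(2) C, where w = "\<lambda>i. v $ i"] by (simp add: cov_index)
  have D: "D_inv_sqrt n s c E = mat_diag s r"
    by (simp add: D_inv_sqrt_def r_def[abs_def])
  have u: "u = Matrix.vec s (\<lambda>i. r i * x $ i)"
    unfolding assms(12) D by (rule mat_diag_mult_vec[OF x])
  have uc: "u \<in> carrier_vec s" by (simp add: u)
  have u0: "0 \<le> u $ i" if "i < s" for i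
  proof -
    have "0 \<le> sigma_sq n s c E i" unfolding sigma_sq_def by (rule integral_nonneg_AE) simp
    thus ?thesis using that x0[OF that] by (simp add: u r_def)
  qed
  define qt where "qt i = r i * q i * r i" for i
  have Qt: "Qt = mat_diag s qt"
    unfolding assms(11) D Q diag_congruence_diag by (simp add: qt_def[abs_def])
  have \<Gamma>: "\<Gamma> = mat_diag s qt + \<gamma> \<cdot>\<^sub>m outer u u"
    unfolding assms(10) D \<Sigma> diag_congruence_update[OF x] assms(12) diag_congruence_diag
    by (simp add: qt_def[abs_def])
  have psd': "0 \<le> v \<bullet> (\<Gamma> *\<^sub>v v)" if "v \<in> carrier_vec s" for v
    unfolding assms(10) D by (rule diag_congruence_psd[OF cov psd that])
  have inverse_q: "minv Q = mat_diag s (\<lambda>i. inverse (q_entry n s c E i))" if "invertible_mat Q"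
    using that unfolding Q q_def invertible_mat_diag by (rule minv_mat_diag)
  have entry: "mat_diag s f $$ (i, i) = f i" if "i < s" for f :: "nat \<Rightarrow> real" and i
    using that by (simp add: mat_diag_def)
  show ?thesis
    unfolding Let_def
  proof (intro conjI allI impI)
    show "sigma_sq n s c E i =
        m * (ffact (c i) 2 / ffact n 2) * (1 - m * (ffact (c i) 2 / ffact n 2))
        + 2 * ((ffact (c i) 3 / ffact n 3 - ffact (c i) 4 / ffact n 4) * real (pi3 E)
               + ffact (c i) 4 / ffact n 4 * real (card E choose 2))" if "i < s" for i
      unfolding var assms(5) by (rule covariance_mono_edges_same[OF assms(2) C that])
  next
    show "\<Sigma> = Q + \<gamma> \<cdot>\<^sub>m outer x x" by (simp only: \<Sigma> Q)
  next
    assume inv: "invertible_mat Q"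
    let ?a = "minv Q *\<^sub>v x"
    let ?d = "1 + \<gamma> * scalar_prod ?a (Q *\<^sub>v ?a)"
    show "invertible_mat \<Sigma> \<longleftrightarrow> ?d \<noteq> 0"
      using sherman_morrison_minv(1)[OF x, where q = q and \<gamma> = \<gamma>] inv unfolding Q \<Sigma> by blast
    show "minv \<Sigma> = mat_diag s (\<lambda>i. inverse (q_entry n s c E i)) - (\<gamma> / ?d) \<cdot>\<^sub>m outer ?a ?a"
      if "?d \<noteq> 0"
      using sherman_morrison_minv(2)[OF x, where q = q and \<gamma> = \<gamma>] inv that
      unfolding inverse_q[OF inv, symmetric] unfolding Q \<Sigma> by blast
  next
    fix S assume "\<gamma> \<le> 0 \<and> invertible_mat \<Sigma>" and "S \<noteq> {} \<and> S \<subseteq> {..<s}"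
    thus "M_matrix (principal_submatrix \<Sigma> S)"
      using M_matrix_update[OF x x0 psd[unfolded \<Sigma>]] unfolding \<Sigma> by blast
  next
    fix S assume "\<gamma> \<ge> 0 \<and> invertible_mat \<Sigma> \<and> (s \<le> 2 \<or> (\<forall>i<s. 0 \<le> Q $$ (i, i)))"
      and "S \<noteq> {} \<and> S \<subseteq> {..<s}"
    thus "M_matrix (principal_submatrix (minv \<Sigma>) S)"
      using M_matrix_minv_update[OF x x0 psd[unfolded \<Sigma>]] entry[of _ q] unfolding \<Sigma> Q by metis
  next
    show "diagonal_mat Qt" unfolding Qt by (rule diagonal_mat_mat_diag)
  next
    show "\<Gamma> = Qt + \<gamma> \<cdot>\<^sub>m outer u u" by (simp only: \<Gamma> Qt)
  next
    assume inv: "invertible_mat Qt"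
    let ?b = "minv Qt *\<^sub>v u"
    let ?d = "1 + \<gamma> * scalar_prod ?b (Qt *\<^sub>v ?b)"
    show "invertible_mat \<Gamma> \<longleftrightarrow> ?d \<noteq> 0"
      using sherman_morrison_minv(1)[OF uc, where q = qt and \<gamma> = \<gamma>] inv unfolding Qt \<Gamma> by blast
    show "minv \<Gamma> = minv Qt - (\<gamma> / ?d) \<cdot>\<^sub>m outer ?b ?b" if "?d \<noteq> 0"
      using sherman_morrison_minv(2)[OF uc, where q = qt and \<gamma> = \<gamma>] inv that unfolding Qt \<Gamma> by blast
  next
    fix S assume "\<gamma> \<le> 0 \<and> invertible_mat \<Gamma>" and "S \<noteq> {} \<and> S \<subseteq> {..<s}"
    thus "M_matrix (principal_submatrix \<Gamma> S)"
      using M_matrix_update[OF uc u0 psd'[unfolded \<Gamma>]] unfolding \<Gamma> by blast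
  next
    fix S assume "\<gamma> \<ge> 0 \<and> invertible_mat \<Gamma> \<and> (s \<le> 2 \<or> (\<forall>i<s. 0 \<le> Qt $$ (i, i)))"
      and "S \<noteq> {} \<and> S \<subseteq> {..<s}"
    thus "M_matrix (principal_submatrix (minv \<Gamma>) S)"
      using M_matrix_minv_update[OF uc u0 psd'[unfolded \<Gamma>]] entry[of _ qt] unfolding \<Gamma> Qt by metis
  qed
qed

end
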